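(* Let $k\geq 2$, $q\ge1$ be integers and $\mathcal{A}$ as in the context. For the type-$\mathcal{A}$ random walk on $\mathbb{Z}^k$, let $\overline{R}_{n,k}=\frac1n(X_1X_2+X_2X_3+\cdots+X_nX_{n+1})$. Then $$\lim_{n\to\infty}\overline{R}_{n,k}=\prod_p\Big(1-\frac{2}{p^k}\Big)$$ almost surely, where $p$ runs over all primes.
   Context: $\mathcal{A}=\{\boldsymbol{\alpha}_1,\dots,\boldsymbol{\alpha}_q\}$ is a finite set of vectors $\boldsymbol{\alpha}_t=(\alpha_{t,1},\dots,\alpha_{t,k})$ with $0<\alpha_{t,j}<1$ for all $j$ and $\alpha_{t,1}+\cdots+\alpha_{t,k}=1$. For $\boldsymbol{\alpha}=(\alpha_1,\dots,\alpha_k)$ of this form, a type-$\boldsymbol{\alpha}$ step $\mathbf{w}(\boldsymbol{\alpha})$ is a random vector equal to the $j$-th standard basis vector of $\mathbb{Z}^k$ with probability $\alpha_j$. The type-$\mathcal{A}$ random walk is $\mathbf{p}_0=(0,\dots,0)$, $\mathbf{p}_i=\mathbf{p}_{i-1}+\mathbf{w}(\boldsymbol{\alpha}'_i)$ for $i\ge1$, where at each step a type $\boldsymbol{\alpha}'_i\in\mathcal{A}$ is chosen and the steps are independent. A lattice point $\mathbf{n}=(n_1,\dots,n_k)\in\mathbb{Z}^k$ is visible if there is no other lattice point on the segment joining it to the origin (equivalently $\gcd(n_1,\dots,n_k)=1$). $X_i=1$ if $\mathbf{p}_i$ is visible and $X_i=0$ otherwise. *)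

theory Defs
  imports "HOL-Probability.Probability" "HOL-Computational_Algebra.Primes"
begin

text \<open>The walk step at time m moves in coordinate direction W m \<omega> (an index j < k).
  The position after i steps, as a lattice point indexed by coordinates j < k.\<close>
definition walk_pos :: "(nat \<Rightarrow> 'a \<Rightarrow> nat) \<Rightarrow> nat \<Rightarrow> 'a \<Rightarrow> nat \<Rightarrow> int" where
  "walk_pos W i \<omega> j = int (card {m \<in> {1..i}. W m \<omega> = j})"

definition visible :: "nat \<Rightarrow> (nat \<Rightarrow> int) \<Rightarrow> bool" where
  "visible k n \<longleftrightarrow> Gcd (n ` {..<k}) = 1"

definition vis_ind :: "nat \<Rightarrow> (nat \<Rightarrow> 'a \<Rightarrow> nat) \<Rightarrow> nat \<Rightarrow> 'a \<Rightarrow> real" where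
  "vis_ind k W i \<omega> = (if visible k (walk_pos W i \<omega>) then 1 else 0)"

end

theory Submission
  imports Defs "HOL-Library.Function_Algebras" "HOL-Number_Theory.Cong" "HOL-Real_Asymp.Real_Asymp"
begin

text \<open>
  Conditionally on the walk up to time \<open>i - L\<close>, the law of the position at time \<open>i\<close> is nearly invariant
  under replacing one step in direction \<open>e\<^sub>a\<close> by one in direction \<open>e\<^sub>b\<close>, with an error
  \<open>O(1 / sqrt L)\<close> uniform in the past. Averaging over such replacements shows that for any fixed set of
  primes the residues become equidistributed subject to the coordinates summing to \<open>i\<close>, and that a divisor
  \<open>d\<close> of \<open>i\<close> divides the first coordinate with probability at most \<open>1 / d + O(L\<^bsup>-1/4\<^esup>)\<close>.
  A prime can only divide the position at time \<open>i\<close> if it divides \<open>i\<close>, so on average over \<open>i\<close> the large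
  primes contribute little, and the conditional probability that both \<open>p\<^sub>i\<close> and \<open>p\<^bsub>i+1\<^esub>\<close> are
  visible is, on average over \<open>i\<close>, close to the product over small primes. The differences between
  \<open>X\<^sub>i X\<^bsub>i+1\<^esub>\<close> and its conditional probability are uncorrelated at distances greater than \<open>L\<close>; with
  \<open>n = m\<^sup>4\<close> and \<open>L = m\<^sup>2\<close> the variance of their mean is \<open>O(1 / m\<^sup>2)\<close>, which is summable.
\<close>

section \<open>Transition operators and their gradients\<close>

text \<open>Left active, this rule would rewrite sums of vectors in argument position into lambda abstractions.\<close>

declare plus_fun_apply [simp del]

definition unit_vec :: "nat \<Rightarrow> nat \<Rightarrow> int" where
  "unit_vec l = (\<lambda>i. of_bool (i = l))"

text \<open>The expectation of \<open>\<phi>\<close> one step after \<open>x\<close>. Arguments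
  range over all integer vectors, so points can be translated freely, even outside the reach of the
  walk.\<close>

definition step_op :: "nat \<Rightarrow> (nat \<Rightarrow> real) \<Rightarrow> ((nat \<Rightarrow> int) \<Rightarrow> real) \<Rightarrow> (nat \<Rightarrow> int) \<Rightarrow> real" where
  "step_op k w \<phi> x = (\<Sum>l<k. w l * \<phi> (x + unit_vec l))"

definition steps_op :: "nat \<Rightarrow> (nat \<Rightarrow> real) list \<Rightarrow> ((nat \<Rightarrow> int) \<Rightarrow> real) \<Rightarrow> (nat \<Rightarrow> int) \<Rightarrow> real" where
  "steps_op k ws = foldr (step_op k) ws"

text \<open>With \<open>c = 0\<close> this is a probability vector, which gives monotonicity; a
  positive \<open>c\<close>, common to all steps, gives the smoothing.\<close>

definition weights :: "nat \<Rightarrow> real \<Rightarrow> (nat \<Rightarrow> real) \<Rightarrow> bool" where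
  "weights k c w \<longleftrightarrow> (\<Sum>l<k. w l) = 1 \<and> (\<forall>l<k. c \<le> w l)"

section \<open>Linearity and commutation of the transition operators\<close>

lemma steps_op_Nil [simp]: "steps_op k [] \<phi> = \<phi>"
  and steps_op_Cons [simp]: "steps_op k (w # ws) \<phi> = step_op k w (steps_op k ws \<phi>)"
  and steps_op_append: "steps_op k (ws @ vs) \<phi> = steps_op k ws (steps_op k vs \<phi>)"
  by (simp_all add: steps_op_def)

text \<open>Increments are added in a commutative group, so the order of independent steps does not
  affect the resulting law. This permits collecting equal steps.\<close>

lemma step_op_commute: "step_op k v (step_op k w \<phi>) = step_op k w (step_op k v \<phi>)"
proof
  fix x
  have "step_op k v (step_op k w \<phi>) x = (\<Sum>l<k. \<Sum>m<k. v l * (w m * \<phi> (x + unit_vec l + unit_vec m)))"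
    by (simp add: step_op_def sum_distrib_left)
  also have "\<dots> = (\<Sum>m<k. \<Sum>l<k. v l * (w m * \<phi> (x + unit_vec l + unit_vec m)))"
    by (rule sum.swap)
  also have "\<dots> = step_op k w (step_op k v \<phi>) x"
    by (simp add: step_op_def sum_distrib_left ac_simps)
  finally show "step_op k v (step_op k w \<phi>) x = step_op k w (step_op k v \<phi>) x" .
qed

lemma step_op_const: "weights k c w \<Longrightarrow> step_op k w (\<lambda>_. a) x = a"
  by (simp add: step_op_def weights_def flip: sum_distrib_right)

lemma steps_op_const: "\<forall>w\<in>set ws. weights k c w \<Longrightarrow> steps_op k ws (\<lambda>_. a) = (\<lambda>_. a)"
  by (induction ws) (auto simp: step_op_const)

lemma steps_op_add: "steps_op k ws (\<lambda>z. \<phi> z + \<psi> z) x = steps_op k ws \<phi> x + steps_op k ws \<psi> x"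
proof (induction ws arbitrary: x)
  case (Cons w ws)
  then have "steps_op k ws (\<lambda>z. \<phi> z + \<psi> z) = (\<lambda>x. steps_op k ws \<phi> x + steps_op k ws \<psi> x)"
    by blast
  then show ?case by (simp add: step_op_def distrib_left sum.distrib)
qed simp

lemma steps_op_cmult: "steps_op k ws (\<lambda>z. a * \<phi> z) x = a * steps_op k ws \<phi> x"
proof (induction ws arbitrary: x)
  case (Cons w ws)
  then have "steps_op k ws (\<lambda>z. a * \<phi> z) = (\<lambda>x. a * steps_op k ws \<phi> x)"
    by blast
  then show ?case by (simp add: step_op_def sum_distrib_left ac_simps)
qed simp

lemma steps_op_diff: "steps_op k ws (\<lambda>z. \<phi> z - \<psi> z) x = steps_op k ws \<phi> x - steps_op k ws \<psi> x"
  using steps_op_add[of k ws \<phi> "\<lambda>z. -1 * \<psi> z" x] by (simp only: steps_op_cmult) simp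

lemma steps_op_sum: "steps_op k ws (\<lambda>z. \<Sum>s\<in>S. \<phi> s z) x = (\<Sum>s\<in>S. steps_op k ws (\<phi> s) x)"
proof (induction S rule: infinite_finite_induct)
  case (insert s S)
  then show ?case by (simp add: steps_op_add)
qed (use steps_op_cmult[of k ws 0] in simp_all)

lemma steps_op_shift: "steps_op k ws (\<lambda>z. \<phi> (z + v)) x = steps_op k ws \<phi> (x + v)"
proof (induction ws arbitrary: x)
  case (Cons w ws)
  then have "steps_op k ws (\<lambda>z. \<phi> (z + v)) = (\<lambda>x. steps_op k ws \<phi> (x + v))"
    by blast
  then show ?case by (simp add: step_op_def add.assoc add.commute[of v])
qed simp

section \<open>Positivity and contraction\<close>

lemma sum_add_unit_vec: "l < k \<Longrightarrow> (\<Sum>j<k. (x + unit_vec l) j) = (\<Sum>j<k. x j) + 1"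
  by (simp add: plus_fun_apply unit_vec_def sum.distrib of_bool_def)

text \<open>Only endpoints with the coordinate sum forced by the number of steps are compared. The
  later sieve inequalities hold only there, because they use that the coordinates sum to
  \<open>i\<close>.\<close>

lemma steps_op_mono:
  assumes "\<forall>w\<in>set ws. weights k c w" "c \<ge> 0"
    and "\<And>z. (\<Sum>j<k. z j) = (\<Sum>j<k. x j) + int (length ws) \<Longrightarrow> \<phi> z \<le> \<psi> z"
  shows "steps_op k ws \<phi> x \<le> steps_op k ws \<psi> x"
  using assms
proof (induction ws arbitrary: x)
  case (Cons w ws)
  have "steps_op k ws \<phi> (x + unit_vec l) \<le> steps_op k ws \<psi> (x + unit_vec l)" if "l < k" for l
    using Cons.prems by (intro Cons.IH) (auto simp: sum_add_unit_vec[OF that])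
  moreover have "0 \<le> w l" if "l < k" for l
    using Cons.prems that by (force simp: weights_def)
  ultimately show ?case by (auto simp: step_op_def intro!: sum_mono mult_left_mono)
qed (auto)

lemma steps_op_abs_le:
  assumes "\<forall>w\<in>set ws. weights k c w" "c \<ge> 0" and "\<And>z. \<bar>\<phi> z\<bar> \<le> B"
  shows "\<bar>steps_op k ws \<phi> x\<bar> \<le> B"
proof -
  have "steps_op k ws \<phi> x \<le> steps_op k ws (\<lambda>_. B) x" "steps_op k ws (\<lambda>_. - B) x \<le> steps_op k ws \<phi> x"
    using assms(3) by (intro steps_op_mono[OF assms(1,2)]; simp add: abs_le_iff minus_le_iff)+
  then show ?thesis by (simp add: steps_op_const[OF assms(1)])
qed

section \<open>Variance, gradients and flatness\<close>

lemma step_op_variance: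
  assumes w: "weights k c w" and c: "c \<ge> 0" and ij: "i < k" "j < k" "i \<noteq> j"
  shows "step_op k w (\<lambda>z. (\<phi> z)\<^sup>2) x - (step_op k w \<phi> x)\<^sup>2
           \<ge> c / 2 * (\<phi> (x + unit_vec i) - \<phi> (x + unit_vec j))\<^sup>2"
proof -
  define f where "f l = \<phi> (x + unit_vec l)" for l
  define \<mu> where "\<mu> = (\<Sum>l<k. w l * f l)"
  have w1: "(\<Sum>l<k. w l) = 1" and wc: "\<And>l. l < k \<Longrightarrow> c \<le> w l" using w by (auto simp: weights_def)
  have "(\<Sum>l<k. w l * (f l - \<mu>)\<^sup>2) = (\<Sum>l<k. w l * (f l)\<^sup>2 - 2 * \<mu> * (w l * f l) + \<mu>\<^sup>2 * w l)"
    by (intro sum.cong) (auto simp: power2_eq_square algebra_simps)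
  also have "\<dots> = (\<Sum>l<k. w l * (f l)\<^sup>2) - 2 * \<mu> * \<mu> + \<mu>\<^sup>2"
    unfolding sum.distrib sum_subtractf sum_distrib_left[symmetric] w1 \<mu>_def[symmetric] by simp
  finally have var: "(\<Sum>l<k. w l * (f l - \<mu>)\<^sup>2) = (\<Sum>l<k. w l * (f l)\<^sup>2) - \<mu>\<^sup>2"
    by (simp add: power2_eq_square)
  \<comment> \<open>\<open>f i\<close> and \<open>f j\<close> cannot both be close to the mean: the
    squares of their deviations sum to at least half the squared difference.\<close>
  have "c / 2 * (f i - f j)\<^sup>2 \<le> c * (f i - \<mu>)\<^sup>2 + c * (f j - \<mu>)\<^sup>2"
  proof -
    have "(f i - f j)\<^sup>2 \<le> 2 * ((f i - \<mu>)\<^sup>2 + (f j - \<mu>)\<^sup>2)"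
      using zero_le_power2[of "f i - \<mu> + (f j - \<mu>)"] by (simp add: power2_eq_square algebra_simps)
    from mult_left_mono[OF this c] show ?thesis by (simp add: algebra_simps)
  qed
  also have "\<dots> \<le> w i * (f i - \<mu>)\<^sup>2 + w j * (f j - \<mu>)\<^sup>2"
    using wc ij by (intro add_mono mult_right_mono) auto
  also have "\<dots> = (\<Sum>l\<in>{i,j}. w l * (f l - \<mu>)\<^sup>2)" using ij by simp
  also have "\<dots> \<le> (\<Sum>l<k. w l * (f l - \<mu>)\<^sup>2)"
    using ij wc c by (intro sum_mono2) (auto intro!: mult_nonneg_nonneg intro: order_trans)
  finally show ?thesis unfolding var by (simp add: f_def \<mu>_def step_op_def)
qed

text \<open>Jensen's inequality, by expanding the nonnegative second moment about the mean
  \<open>a\<close>.\<close>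

lemma steps_op_square_le:
  assumes "\<forall>w\<in>set ws. weights k c w" "c \<ge> 0"
  shows "(steps_op k ws \<phi> x)\<^sup>2 \<le> steps_op k ws (\<lambda>z. (\<phi> z)\<^sup>2) x"
proof -
  define a where "a = steps_op k ws \<phi> x"
  have "0 = steps_op k ws (\<lambda>_. 0) x" by (simp add: steps_op_const[OF assms(1)])
  also have "\<dots> \<le> steps_op k ws (\<lambda>z. (\<phi> z - a)\<^sup>2) x"
    by (rule steps_op_mono[OF assms]) auto
  also have "(\<lambda>z. (\<phi> z - a)\<^sup>2) = (\<lambda>z. ((\<phi> z)\<^sup>2 + a\<^sup>2) - 2 * a * \<phi> z)"
    by (auto simp: power2_eq_square algebra_simps)
  also have "steps_op k ws \<dots> x = steps_op k ws (\<lambda>z. (\<phi> z)\<^sup>2) x - a\<^sup>2"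
    by (simp only: steps_op_diff steps_op_add steps_op_cmult steps_op_const[OF assms(1)] a_def[symmetric])
       (simp add: power2_eq_square)
  finally show ?thesis by (simp add: a_def)
qed

text \<open>Each step contributes to the variance at least \<open>c / 2\<close> times the square of the gradient of the later steps; as all steps are equal, by Jensen each of these contributions dominates the same squared gradient.\<close>

lemma replicate_gradient_variance:
  assumes w: "weights k c w" and c: "c \<ge> 0" and ij: "i < k" "j < k" "i \<noteq> j"
  shows "real (Suc n) * (c / 2) * (steps_op k (replicate n w) \<phi> (x + unit_vec i)
              - steps_op k (replicate n w) \<phi> (x + unit_vec j))\<^sup>2
         \<le> steps_op k (replicate (Suc n) w) (\<lambda>z. (\<phi> z)\<^sup>2) x - (steps_op k (replicate (Suc n) w) \<phi> x)\<^sup>2"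
proof (induction n arbitrary: \<phi>)
  case 0
  show ?case using step_op_variance[OF assms] by simp
next
  case (Suc n)
  let ?R = "steps_op k (replicate (Suc n) w)"
  let ?T = "step_op k w"
  let ?g = "?R \<phi> (x + unit_vec i) - ?R \<phi> (x + unit_vec j)"
  have ws: "\<forall>v\<in>set (replicate (Suc n) w). weights k c v" using w by auto
  have last: "steps_op k (replicate (Suc m) w) \<psi> = steps_op k (replicate m w) (?T \<psi>)" for m \<psi>
    using replicate_append_same[of m w] steps_op_append[of k "replicate m w" "[w]" \<psi>] by simp
  have g: "?g = ?R (\<lambda>z. \<phi> (z + unit_vec i) - \<phi> (z + unit_vec j)) x"
    by (simp only: steps_op_diff steps_op_shift)
  \<comment> \<open>The variance splits into the mean conditional variance of the final step,
    bounded in \<open>A\<close>, and the variance of the conditional mean, bounded in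
    \<open>B\<close> by induction.\<close>
  have "c / 2 * ?g\<^sup>2 \<le> c / 2 * ?R (\<lambda>z. (\<phi> (z + unit_vec i) - \<phi> (z + unit_vec j))\<^sup>2) x"
    unfolding g using c by (intro mult_left_mono steps_op_square_le[OF ws]) auto
  also have "\<dots> = ?R (\<lambda>z. c / 2 * (\<phi> (z + unit_vec i) - \<phi> (z + unit_vec j))\<^sup>2) x"
    by (simp only: steps_op_cmult)
  also have "\<dots> \<le> ?R (\<lambda>z. ?T (\<lambda>z. (\<phi> z)\<^sup>2) z - (?T \<phi> z)\<^sup>2) x"
    by (rule steps_op_mono[OF ws c]) (rule step_op_variance[OF assms])
  also have "\<dots> = ?R (?T (\<lambda>z. (\<phi> z)\<^sup>2)) x - ?R (\<lambda>z. (?T \<phi> z)\<^sup>2) x"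
    by (simp only: steps_op_diff)
  finally have A: "c / 2 * ?g\<^sup>2 \<le> \<dots>" .
  have B: "real (Suc n) * (c / 2) * ?g\<^sup>2 \<le> ?R (\<lambda>z. (?T \<phi> z)\<^sup>2) x - (?R (?T \<phi>) x)\<^sup>2"
    using Suc.IH[of "?T \<phi>"] by (simp only: last[symmetric])
  have "real (Suc (Suc n)) * (c / 2) * ?g\<^sup>2 = c / 2 * ?g\<^sup>2 + real (Suc n) * (c / 2) * ?g\<^sup>2"
    by (simp add: field_simps)
  also have "\<dots> \<le> ?R (?T (\<lambda>z. (\<phi> z)\<^sup>2)) x - (?R (?T \<phi>) x)\<^sup>2" using A B by linarith
  finally show ?case by (simp only: last[of "Suc n"])
qed

text \<open>The law of the walk after the steps \<open>ws\<close> changes by at most \<open>\<eta>\<close> when one additional step is redirected.\<close>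

definition flat :: "nat \<Rightarrow> real \<Rightarrow> (nat \<Rightarrow> real) list \<Rightarrow> bool" where
  "flat k \<eta> ws \<longleftrightarrow> (\<forall>\<phi> x i j. (\<forall>z. \<bar>\<phi> z\<bar> \<le> 1) \<longrightarrow> i < k \<longrightarrow> j < k \<longrightarrow>
      \<bar>steps_op k ws \<phi> (x + unit_vec i) - steps_op k ws \<phi> (x + unit_vec j)\<bar> \<le> \<eta>)"

text \<open>A function bounded by 1 has variance at most 1 after \<open>n + 1\<close> steps, so the
  preceding bound forces the squared gradient below \<open>2 / (c * n)\<close>.\<close>

lemma flat_replicate:
  fixes c :: real and n :: nat
  assumes w: "weights k c w" and c: "c > 0" and n: "n > 0"
  shows "flat k (sqrt (2 / (c * n))) (replicate n w)"
  unfolding flat_def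
proof (intro allI impI)
  fix \<phi> :: "(nat \<Rightarrow> int) \<Rightarrow> real" and x :: "nat \<Rightarrow> int" and i j
  assume \<phi>: "\<forall>z. \<bar>\<phi> z\<bar> \<le> 1" and ij: "i < k" "j < k"
  let ?d = "steps_op k (replicate n w) \<phi> (x + unit_vec i) - steps_op k (replicate n w) \<phi> (x + unit_vec j)"
  show "\<bar>?d\<bar> \<le> sqrt (2 / (c * n))"
  proof (cases "i = j")
    case False
    have ws: "\<forall>v\<in>set (replicate (Suc n) w). weights k c v" using w by auto
    have "real n * (c / 2) * ?d\<^sup>2 \<le> real (Suc n) * (c / 2) * ?d\<^sup>2"
      using c by (intro mult_right_mono) auto
    also have "\<dots> \<le> steps_op k (replicate (Suc n) w) (\<lambda>z. (\<phi> z)\<^sup>2) x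
                     - (steps_op k (replicate (Suc n) w) \<phi> x)\<^sup>2"
      using c by (intro replicate_gradient_variance w ij False) auto
    also have "\<dots> \<le> steps_op k (replicate (Suc n) w) (\<lambda>z. (\<phi> z)\<^sup>2) x" by simp
    also have "\<dots> \<le> steps_op k (replicate (Suc n) w) (\<lambda>z. 1) x"
      using c \<phi> by (intro steps_op_mono[OF ws]) (auto simp: abs_square_le_1)
    finally have "real n * (c / 2) * ?d\<^sup>2 \<le> 1" by (simp only: steps_op_const[OF ws])
    then have "?d\<^sup>2 \<le> 2 / (c * n)" using c n by (simp add: field_simps)
    then show ?thesis by (metis real_sqrt_abs real_sqrt_le_mono)
  qed (use c in auto)
qed

text \<open>Commutation moves all steps of type \<open>t\<close> to the front; the remaining steps
  merely turn \<open>\<phi>\<close> into another test function.\<close>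

lemma steps_op_rearrange:
  "steps_op k (map f ts) \<phi> =
     steps_op k (replicate (count_list ts t) (f t)) (steps_op k (map f (filter (\<lambda>s. s \<noteq> t) ts)) \<phi>)"
proof (induction ts)
  case (Cons s ts)
  have "step_op k v (steps_op k (replicate n w) \<psi>) = steps_op k (replicate n w) (step_op k v \<psi>)" for v w n \<psi>
    by (induction n) (auto simp: step_op_commute[of k v])
  then show ?case using Cons.IH by auto
qed simp

lemma count_list_pigeonhole:
  assumes "\<forall>t\<in>set ts. t < q" and "ts \<noteq> []"
  shows "\<exists>t\<in>set ts. length ts \<le> q * count_list ts t"
proof (rule ccontr)
  assume "\<not> ?thesis"
  then have *: "q * count_list ts t < length ts" if "t \<in> set ts" for t using that by auto
  have sub: "set ts \<subseteq> {..<q}" using assms(1) by auto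
  have "q * length ts = (\<Sum>t\<in>set ts. q * count_list ts t)"
    using sum_count_set[of ts "set ts"] by (simp flip: sum_distrib_left)
  also have "\<dots> < (\<Sum>t\<in>set ts. length ts)"
    using * assms(2) by (intro sum_strict_mono) auto
  also have "\<dots> \<le> q * length ts" using card_mono[OF _ sub] by simp
  finally show False by simp
qed

text \<open>The transition operators commute, so it suffices to exploit the most frequent type.\<close>

lemma flat_steps:
  fixes c :: real and q :: nat and ts :: "nat list"
  assumes w: "\<forall>t<q. weights k c (f t)" and c: "c > 0" and ts: "\<forall>t\<in>set ts. t < q" "ts \<noteq> []"
  shows "flat k (sqrt (2 * q / (c * length ts))) (map f ts)"
proof -
  obtain t where t: "t \<in> set ts" "length ts \<le> q * count_list ts t"
    using count_list_pigeonhole[OF ts] by blast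
  let ?n = "count_list ts t"
  have n: "?n > 0" using t(1) by (simp add: count_list_0_iff zero_less_iff_neq_zero)
  have le: "2 / (c * ?n) \<le> 2 * q / (c * length ts)"
    using t(2) ts(2) n c by (simp add: field_simps flip: of_nat_mult)
  have "flat k (sqrt (2 / (c * ?n))) (replicate ?n (f t))"
    using w ts(1) t(1) by (intro flat_replicate[OF _ c n]) auto
  moreover have "\<bar>steps_op k (map f (filter (\<lambda>s. s \<noteq> t) ts)) \<phi> z\<bar> \<le> 1" if "\<forall>z. \<bar>\<phi> z\<bar> \<le> 1" for \<phi> z
    using that w ts(1) c by (intro steps_op_abs_le[where c=c]) auto
  ultimately show ?thesis
    unfolding flat_def steps_op_rearrange[of k f ts _ t]
    using le by (blast intro: order_trans real_sqrt_le_mono)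
qed

section \<open>Divisibility after many steps\<close>

text \<open>Moves \<open>t\<close> units from coordinate \<open>j\<close> to coordinate
  \<open>i\<close>; for coordinates below \<open>k\<close> this keeps the coordinate sum.\<close>

definition transfer :: "nat \<Rightarrow> nat \<Rightarrow> nat \<Rightarrow> nat \<Rightarrow> int" where
  "transfer i j t = (\<lambda>l. int t * (unit_vec i l - unit_vec j l))"

text \<open>A transfer of \<open>t\<close> units is a chain of \<open>t\<close> redirections of a
  single step, each costing at most \<open>\<eta>\<close>.\<close>

lemma flat_transfer:
  fixes t :: nat and \<eta> :: real
  assumes flat: "flat k \<eta> ws" and \<phi>: "\<And>z. \<bar>\<phi> z\<bar> \<le> 1" and ij: "i < k" "j < k"
  shows "\<bar>steps_op k ws \<phi> (x + transfer i j t) - steps_op k ws \<phi> x\<bar> \<le> t * \<eta>"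
proof (induction t)
  case 0
  have "x + transfer i j 0 = x" by (simp add: transfer_def plus_fun_apply fun_eq_iff)
  then show ?case by (simp only:)
next
  case (Suc t)
  \<comment> \<open>Removing one unit in direction \<open>j\<close> gives the common base point of
    the two neighbouring positions. Its coordinates may be negative.\<close>
  define y where "y = (\<lambda>l. (x + transfer i j t) l - unit_vec j l)"
  have "x + transfer i j (Suc t) = y + unit_vec i" "x + transfer i j t = y + unit_vec j"
    by (auto simp: fun_eq_iff y_def transfer_def plus_fun_apply algebra_simps)
  moreover have "\<bar>steps_op k ws \<phi> (y + unit_vec i) - steps_op k ws \<phi> (y + unit_vec j)\<bar> \<le> \<eta>"
    using flat \<phi> ij by (auto simp: flat_def)
  ultimately show ?case using Suc by (simp add: algebra_simps)
qed

section \<open>Residues met by arithmetic progressions\<close>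

lemma sum_of_bool_dvd_le_1:
  assumes "T \<le> d"
  shows "(\<Sum>s<T. of_bool (int d dvd y + int s)) \<le> (1::real)"
proof -
  have "(\<Sum>s<T. of_bool (int d dvd y + int s)) = real (card {s. s < T \<and> int d dvd y + int s})"
    by (simp add: sum.If_cases of_bool_def Collect_conj_eq lessThan_def)
  also have "card {s. s < T \<and> int d dvd y + int s} \<le> 1"
  proof (rule card_le_Suc0_iff_eq[THEN iffD2, unfolded One_nat_def[symmetric]]; clarsimp?)
    fix s s' assume *: "s < T" "s' < T" "int d dvd y + int s" "int d dvd y + int s'"
    then have "int d dvd (y + int s) - (y + int s')" by (intro dvd_diff)
    then have "int d dvd int s - int s'" by simp
    moreover have "\<bar>int s - int s'\<bar> < int d" using * assms by linarith
    ultimately show "s = s'" using zdvd_imp_le[of "int d" "\<bar>int s - int s'\<bar>"] by fastforce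
  qed
  finally show ?thesis by simp
qed

text \<open>As \<open>N\<close> is invertible modulo \<open>p\<close>, any \<open>p\<close>
  consecutive terms of the progression meet every residue class once.\<close>

lemma sum_of_bool_dvd_eq_1:
  fixes p N :: nat
  assumes "coprime N p" "p > 0"
  shows "(\<Sum>s<p. of_bool (int p dvd y + int N * int s)) = (1::real)"
proof -
  have "\<exists>!s. s < p \<and> int p dvd y + int N * int s"
  proof -
    obtain x where x: "[int N * x = 1] (mod int p)"
      using assms(1) cong_solve_coprime_int[of "int N" "int p"] by auto
    define s where "s = nat ((- y * x) mod int p)"
    have s: "int s = (- y * x) mod int p" "s < p"
      using assms(2) by (auto simp: s_def nat_less_iff)
    have "[int N * int s = int N * (- y * x)] (mod int p)"
      unfolding s by (intro cong_mult) (auto simp: cong_def)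
    also have "int N * (- y * x) = (int N * x) * (- y)" by simp
    also have "[\<dots> = 1 * (- y)] (mod int p)" by (intro cong_mult x) auto
    finally have "int p dvd int N * int s - (1 * (- y))" by (simp add: cong_iff_dvd_diff)
    then have "int p dvd y + int N * int s" by (simp add: add.commute)
    moreover have "s' = s" if "s' < p" "int p dvd y + int N * int s'" for s'
    proof -
      have "int p dvd (y + int N * int s') - (y + int N * int s)"
        using that(2) \<open>int p dvd y + int N * int s\<close> by (rule dvd_diff)
      then have "int p dvd int N * (int s' - int s)" by (simp add: algebra_simps)
      then have "int p dvd int s' - int s"
        using assms(1) by (simp add: coprime_commute coprime_dvd_mult_right_iff)
      then have "[s' = s] (mod p)" by (simp add: cong_iff_dvd_diff flip: cong_int_iff)
      then show ?thesis using that(1) s(2) by (simp add: cong_less_modulus_unique_nat)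
    qed
    ultimately show ?thesis using s(2) by blast
  qed
  then obtain s where "{s. s < p \<and> int p dvd y + int N * int s} = {s}" by blast
  moreover have "(\<Sum>s<p. of_bool (int p dvd y + int N * int s))
                 = real (card {s. s < p \<and> int p dvd y + int N * int s})"
    by (simp add: sum.If_cases of_bool_def Collect_conj_eq lessThan_def)
  ultimately show ?thesis by simp
qed

text \<open>The events obtained by transferring \<open>s < T\<close> units between the first two coordinates are disjoint and have nearly equal probability.\<close>

lemma steps_op_dvd_le:
  fixes d T :: nat and \<eta> :: real
  assumes flat: "flat k \<eta> ws" and w: "\<forall>w\<in>set ws. weights k c w" "c \<ge> 0"
    and k: "k \<ge> 2" and T: "T \<le> d" "T > 0" and \<eta>: "\<eta> \<ge> 0"
  shows "steps_op k ws (\<lambda>z. of_bool (int d dvd z 0 + b)) x \<le> 1 / T + T * \<eta>"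
proof -
  define h where "h = steps_op k ws (\<lambda>z. of_bool (int d dvd z 0 + b))"
  have "real T * h x = (\<Sum>s<T. h x)" by simp
  also have "\<dots> \<le> (\<Sum>s<T. h (x + transfer 0 1 s) + T * \<eta>)"
  proof (rule sum_mono)
    fix s assume "s \<in> {..<T}"
    then have "real s * \<eta> \<le> real T * \<eta>" using \<eta> by (intro mult_right_mono) auto
    moreover have "\<bar>h (x + transfer 0 1 s) - h x\<bar> \<le> real s * \<eta>"
      unfolding h_def using k by (intro flat_transfer[OF flat]) auto
    ultimately show "h x \<le> h (x + transfer 0 1 s) + T * \<eta>" by linarith
  qed
  also have "\<dots> = (\<Sum>s<T. h (x + transfer 0 1 s)) + T * (T * \<eta>)" by (simp add: sum.distrib)
  also have "(\<Sum>s<T. h (x + transfer 0 1 s))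
      = steps_op k ws (\<lambda>z. \<Sum>s<T. of_bool (int d dvd (z + transfer 0 1 s) 0 + b)) x"
    unfolding h_def by (simp only: steps_op_sum steps_op_shift[where \<phi> = "\<lambda>z. of_bool (int d dvd z 0 + b)"])
  also have "(\<lambda>z::nat \<Rightarrow> int. \<Sum>s<T. of_bool (int d dvd (z + transfer 0 1 s) 0 + b) :: real)
      = (\<lambda>z. \<Sum>s<T. of_bool (int d dvd (z 0 + b) + int s))"
    by (simp add: plus_fun_apply transfer_def unit_vec_def algebra_simps)
  also have "steps_op k ws \<dots> x \<le> steps_op k ws (\<lambda>_. 1) x"
    by (intro steps_op_mono[OF w] sum_of_bool_dvd_le_1 T)
  also have "\<dots> = 1" by (simp add: steps_op_const[OF w(1)])
  finally have "real T * h x \<le> 1 + T * (T * \<eta>)" by simp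
  then have "h x \<le> (1 + T * (T * \<eta>)) / T" using T by (simp add: field_simps)
  also have "\<dots> = 1 / T + T * \<eta>" using T by (simp add: field_simps)
  finally show ?thesis by (simp add: h_def)
qed

text \<open>The choice of \<open>T\<close> near \<open>1 / sqrt \<eta>\<close> balances
  \<open>1 / T\<close> against \<open>T * \<eta>\<close>. For smaller \<open>d\<close> the
  constraint \<open>T \<le> d\<close> leads to \<open>T = d\<close>, which leaves the main term
  \<open>1 / d\<close>.\<close>

lemma steps_op_dvd_le_sqrt:
  fixes d :: nat and \<eta> :: real
  assumes flat: "flat k \<eta> ws" and w: "\<forall>w\<in>set ws. weights k c w" "c \<ge> 0"
    and k: "k \<ge> 2" and d: "d > 0" and \<eta>: "\<eta> > 0"
  shows "steps_op k ws (\<lambda>z. of_bool (int d dvd z 0 + b)) x \<le> 1 / d + 3 * sqrt \<eta>"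
proof -
  let ?h = "steps_op k ws (\<lambda>z. of_bool (int d dvd z 0 + b)) x"
  note bound = steps_op_dvd_le[OF flat w k, where b=b and x=x and d=d]
  define r where "r = sqrt \<eta>"
  have r: "r > 0" "\<eta> = r * r" using \<eta> by (simp_all add: r_def)
  show ?thesis
  proof (cases "1 \<le> 1 / r")
    case False
    \<comment> \<open>Here \<open>\<eta> > 1\<close>, and the trivial bound 1 suffices.\<close>
    have "?h \<le> 1" using steps_op_abs_le[OF w, of "\<lambda>z. of_bool (int d dvd z 0 + b)" 1 x] by simp
    moreover have "1 \<le> r" using False r by (simp add: field_simps)
    ultimately have "?h \<le> 0 + 3 * r" by simp
    also have "\<dots> \<le> 1 / d + 3 * r" by (intro add_mono) auto
    finally show ?thesis by (simp add: r_def)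
  next
    case True
    define T where "T = nat \<lfloor>1 / r\<rfloor>"
    have "real T = of_int \<lfloor>1 / r\<rfloor>" using r(1) by (simp add: T_def)
    then have T: "T > 0" "real T \<le> 1 / r" "1 / r < real T + 1"
      using True by (auto simp: T_def)
    \<comment> \<open>Rounding down costs at most a factor 2 because \<open>T \<ge> 1\<close>;
      together with \<open>T * \<eta> \<le> r\<close> this yields the constant 3.\<close>
    have "1 / T \<le> 2 * r"
    proof -
      have "1 / r \<le> 2 * T" using T by linarith
      then show ?thesis using T(1) r(1) by (simp add: field_simps)
    qed
    have Tr: "t * \<eta> \<le> r" if "t \<le> 1 / r" for t
    proof -
      have "t * r \<le> 1" using that r(1) by (simp add: field_simps)
      then show ?thesis using mult_right_mono[of "t * r" 1 r] r by (simp add: mult.assoc)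
    qed
    show ?thesis
    proof (cases "T \<le> d")
      case True
      have "?h \<le> 1 / T + T * \<eta>" using bound[of T] T \<eta> True by auto
      also have "\<dots> \<le> 2 * r + r" using \<open>1 / T \<le> 2 * r\<close> Tr[of "real T"] T(2) by (intro add_mono)
      also have "\<dots> \<le> 1 / d + 3 * r" by simp
      finally show ?thesis by (simp add: r_def)
    next
      case False
      have "real d \<le> 1 / r" using False T by linarith
      have "?h \<le> 1 / d + d * \<eta>" using bound[of d] d \<eta> by auto
      also have "\<dots> \<le> 1 / d + 3 * r" using Tr[of "real d"] \<open>real d \<le> 1 / r\<close> r(1) by simp
      finally show ?thesis by (simp add: r_def)
    qed
  qed
qed

text \<open>Among the transfers of \<open>N s\<close> units with \<open>s < p\<close> exactly one makes coordinate \<open>j\<close> satisfy the congruence modulo \<open>p\<close>, and none affects \<open>\<phi>\<close>.\<close>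

lemma steps_op_dvd_independent:
  fixes p N :: nat and \<eta> :: real
  assumes flat: "flat k \<eta> ws" and \<phi>: "\<And>z. \<bar>\<phi> z\<bar> \<le> 1"
    and inv: "\<And>z t. \<phi> (z + transfer j 0 (N * t)) = \<phi> z"
    and j: "0 < j" "j < k" and p: "coprime N p" "p > 0" and \<eta>: "\<eta> \<ge> 0"
  shows "\<bar>steps_op k ws (\<lambda>z. \<phi> z * of_bool (int p dvd z j + b)) x - steps_op k ws \<phi> x / p\<bar> \<le> p * N * \<eta>"
proof -
  define \<psi> where "\<psi> = (\<lambda>z::nat \<Rightarrow> int. \<phi> z * of_bool (int p dvd z j + b))"
  define h where "h = steps_op k ws \<psi>"
  have "(\<Sum>s<p. h (x + transfer j 0 (N * s)))
      = steps_op k ws (\<lambda>z. \<Sum>s<p. \<psi> (z + transfer j 0 (N * s))) x"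
    unfolding h_def by (simp only: steps_op_sum steps_op_shift)
  also have "(\<lambda>z. \<Sum>s<p. \<psi> (z + transfer j 0 (N * s))) = \<phi>"
  proof
    fix z :: "nat \<Rightarrow> int"
    have "(z + transfer j 0 (N * s)) j + b = (z j + b) + int N * int s" for s
      using j by (simp add: plus_fun_apply transfer_def unit_vec_def)
    then have "(\<Sum>s<p. \<psi> (z + transfer j 0 (N * s)))
        = \<phi> z * (\<Sum>s<p. of_bool (int p dvd (z j + b) + int N * int s))"
      unfolding \<psi>_def inv sum_distrib_left by (simp only:)
    then show "(\<Sum>s<p. \<psi> (z + transfer j 0 (N * s))) = \<phi> z"
      by (simp only: sum_of_bool_dvd_eq_1[OF p])
  qed
  finally have S: "(\<Sum>s<p. h (x + transfer j 0 (N * s))) = steps_op k ws \<phi> x" .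
  have near: "\<bar>h (x + transfer j 0 (N * s)) - h x\<bar> \<le> p * N * \<eta>" if "s < p" for s
  proof -
    have "\<bar>\<psi> z\<bar> \<le> 1" for z using \<phi>[of z] by (simp add: \<psi>_def)
    then have "\<bar>h (x + transfer j 0 (N * s)) - h x\<bar> \<le> real (N * s) * \<eta>"
      unfolding h_def using j by (intro flat_transfer[OF flat]) auto
    also have "\<dots> \<le> (p * N) * \<eta>" using that \<eta> by (intro mult_right_mono) (auto simp flip: of_nat_mult)
    finally show ?thesis by simp
  qed
  have "p * h x - steps_op k ws \<phi> x = (\<Sum>s<p. h x - h (x + transfer j 0 (N * s)))"
    by (simp add: sum_subtractf S)
  also have "\<bar>\<dots>\<bar> \<le> (\<Sum>s<p. p * N * \<eta>)"
    using near by (intro order_trans[OF sum_abs] sum_mono) (simp add: abs_minus_commute)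
  finally have "\<bar>p * (h x - steps_op k ws \<phi> x / p)\<bar> \<le> p * (p * N * \<eta>)"
    using p(2) by (simp add: right_diff_distrib)
  then have "p * \<bar>h x - steps_op k ws \<phi> x / p\<bar> \<le> p * (p * N * \<eta>)"
    by (simp add: abs_mult)
  then show ?thesis using p(2) by (simp add: h_def \<psi>_def)
qed

text \<open>Each new coordinate contributes a factor \<open>1 / p\<close>. Transfers between it and
  coordinate 0 leave the conditions on the other members of \<open>J\<close> unchanged, hence 0 is
  kept out of \<open>J\<close>.\<close>

lemma steps_op_dvd_all:
  fixes p N :: nat and \<eta> :: real
  assumes flat: "flat k \<eta> ws" and \<phi>: "\<And>z. \<bar>\<phi> z\<bar> \<le> 1"
    and inv: "\<And>j z t. 0 < j \<Longrightarrow> \<phi> (z + transfer j 0 (N * t)) = \<phi> z"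
    and J: "finite J" "J \<subseteq> {1..<k}" and p: "coprime N p" "p > 0" and \<eta>: "\<eta> \<ge> 0"
  shows "\<bar>steps_op k ws (\<lambda>z. \<phi> z * (\<Prod>j\<in>J. of_bool (int p dvd z j + b j))) x
           - steps_op k ws \<phi> x / real p ^ card J\<bar> \<le> card J * (p * N * \<eta>)"
  using J
proof (induction J rule: finite_induct)
  case (insert j J)
  define \<psi> where "\<psi> = (\<lambda>z. \<phi> z * (\<Prod>j\<in>J. of_bool (int p dvd z j + b j)))"
  have j: "0 < j" "j < k" using insert.prems by auto
  have "(\<Prod>j\<in>J. of_bool (int p dvd z j + b j)) \<in> {0..1::real}" for z :: "nat \<Rightarrow> int"
    by (auto intro!: prod_nonneg prod_le_1)
  then have \<psi>1: "\<bar>\<psi> z\<bar> \<le> 1" for z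
    using \<phi>[of z] by (auto simp: \<psi>_def abs_mult intro!: mult_le_one)
  have "(z + transfer j 0 (N * t)) l = z l" if "l \<in> J" for z t l
  proof -
    have "l \<noteq> 0" "l \<noteq> j" using that insert by auto
    then show ?thesis by (simp add: plus_fun_apply transfer_def unit_vec_def)
  qed
  then have \<psi>inv: "\<psi> (z + transfer j 0 (N * t)) = \<psi> z" for z t
    unfolding \<psi>_def inv[OF j(1)] by (metis (no_types, lifting) prod.cong)
  have "\<bar>steps_op k ws (\<lambda>z. \<psi> z * of_bool (int p dvd z j + b j)) x - steps_op k ws \<psi> x / p\<bar> \<le> p * N * \<eta>"
    using steps_op_dvd_independent[OF flat \<psi>1 \<psi>inv j p \<eta>] .
  moreover have "\<bar>steps_op k ws \<psi> x / p - steps_op k ws \<phi> x / real p ^ Suc (card J)\<bar> \<le> card J * (p * N * \<eta>)"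
  proof -
    have "steps_op k ws \<psi> x / p - steps_op k ws \<phi> x / real p ^ Suc (card J)
        = (steps_op k ws \<psi> x - steps_op k ws \<phi> x / real p ^ card J) / p"
      by (simp add: diff_divide_distrib mult.commute)
    then have "\<bar>steps_op k ws \<psi> x / p - steps_op k ws \<phi> x / real p ^ Suc (card J)\<bar>
        = \<bar>steps_op k ws \<psi> x - steps_op k ws \<phi> x / real p ^ card J\<bar> / p"
      by (simp add: abs_divide)
    also have "\<dots> \<le> \<bar>steps_op k ws \<psi> x - steps_op k ws \<phi> x / real p ^ card J\<bar> / 1"
      using p(2) by (intro divide_left_mono) auto
    also have "\<dots> \<le> card J * (p * N * \<eta>)" using insert by (simp add: \<psi>_def)
    finally show ?thesis .
  qed
  moreover have "(\<lambda>z. \<phi> z * (\<Prod>j\<in>insert j J. of_bool (int p dvd z j + b j)))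
      = (\<lambda>z. \<psi> z * of_bool (int p dvd z j + b j))"
    using insert by (simp add: \<psi>_def ac_simps)
  moreover have "card (insert j J) = Suc (card J)" using insert by simp
  moreover have "real (Suc (card J)) * (p * N * \<eta>) = card J * (p * N * \<eta>) + p * N * \<eta>"
    by (simp add: algebra_simps)
  ultimately show ?case by simp
qed simp

text \<open>Coordinate 0 is omitted from the inner product: modulo \<open>p\<close> it is determined by the others, because the coordinate sum is known.\<close>

definition sieve_error :: "nat \<Rightarrow> nat set \<Rightarrow> real \<Rightarrow> bool" where
  "sieve_error k Q C \<longleftrightarrow> (\<forall>c ws \<eta> \<beta> b x. flat k \<eta> ws \<longrightarrow> (\<forall>w\<in>set ws. weights k c w) \<longrightarrow> \<eta> \<ge> 0 \<longrightarrow>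
     (\<forall>p\<in>Q. 0 \<le> \<beta> p \<and> \<beta> p \<le> 1) \<longrightarrow>
     \<bar>steps_op k ws (\<lambda>z. \<Prod>p\<in>Q. 1 - \<beta> p * (\<Prod>j\<in>{1..<k}. of_bool (int p dvd z j + b p j))) x
        - (\<Prod>p\<in>Q. 1 - \<beta> p / real p ^ (k - 1))\<bar> \<le> C * \<eta>)"

text \<open>Induction over the primes: the product over the earlier primes depends only on residues
  modulo their product \<open>N\<close>, so transfers by multiples of \<open>N\<close> fix it while
  still moving a coordinate through all residues modulo the new prime. The constant depends on
  \<open>k\<close> and \<open>Q\<close> alone.\<close>

lemma steps_op_sieve:
  assumes "finite Q" "\<forall>p\<in>Q. prime p"
  shows "\<exists>C\<ge>0. sieve_error k Q C"
  using assms
proof (induction Q rule: finite_induct)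
  case empty
  show ?case by (auto simp: sieve_error_def steps_op_const intro!: exI[of _ 0])
next
  case (insert p Q)
  have "\<forall>p\<in>Q. prime p" using insert.prems by blast
  from insert.IH[OF this] obtain C where C: "C \<ge> 0"
    and IH: "sieve_error k Q C" by blast
  define N where "N = \<Prod>Q"
  \<comment> \<open>One \<open>C\<close> for the main term, one for the subtracted term, and
    \<open>p * N\<close> for each of the \<open>k - 1\<close> coordinates tested modulo the new
    prime.\<close>
  define K where "K = 2 * C + real (k - 1) * (p * N)"
  have p: "prime p" "p > 0" using insert.prems prime_gt_0_nat by auto
  have cop: "coprime N p"
    unfolding N_def using insert by (intro prod_coprime_left) (metis insert_iff primes_coprime)
  have "sieve_error k (insert p Q) K"
    unfolding sieve_error_def
  proof (intro allI impI)
    fix c ws \<eta> \<beta> b x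
    assume *: "flat k \<eta> ws" "\<forall>w\<in>set ws. weights k c w" "0 \<le> \<eta>"
      and \<beta>: "\<forall>p\<in>insert p Q. 0 \<le> \<beta> p \<and> \<beta> p \<le> (1::real)"
    define D where "D q = (\<lambda>z::nat \<Rightarrow> int. \<Prod>j\<in>{1..<k}. of_bool (int q dvd z j + b q j) :: real)" for q :: nat
    define F where "F = (\<lambda>z. \<Prod>q\<in>Q. 1 - \<beta> q * D q z)"
    define R where "R = (\<Prod>q\<in>Q. 1 - \<beta> q / real q ^ (k - 1))"
    have D01: "0 \<le> D q z" "D q z \<le> 1" for q z by (auto simp: D_def intro!: prod_nonneg prod_le_1)
    then have "0 \<le> 1 - \<beta> q * D q z \<and> 1 - \<beta> q * D q z \<le> 1" if "q \<in> Q" for q z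
      using \<beta> that by (auto intro!: mult_le_one)
    then have "0 \<le> F z" "F z \<le> 1" for z unfolding F_def by (auto intro!: prod_nonneg prod_le_1)
    then have F1: "\<bar>F z\<bar> \<le> 1" for z by simp
    have inv: "F (z + transfer j 0 (N * t)) = F z" for j z t
    proof -
      have "D q (z + transfer j 0 (N * t)) = D q z" if "q \<in> Q" for q
      proof -
        have "q dvd N" unfolding N_def using dvd_prodI[OF insert.hyps(1) that, of "\<lambda>x. x"] by simp
        then obtain r where r: "N = q * r" by blast
        have "int q dvd (z + transfer j 0 (N * t)) l + b q l \<longleftrightarrow> int q dvd z l + b q l" for l
        proof -
          have "(z + transfer j 0 (N * t)) l + b q l
                  = (z l + b q l) + int q * (int (r * t) * (unit_vec j l - unit_vec 0 l))"
            by (simp add: plus_fun_apply transfer_def r)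
          then show ?thesis by (simp only: dvd_add_times_triv_right_iff[of "int q" "z l + b q l",
                simplified mult.commute[of _ "int q"]])
        qed
        then show ?thesis by (simp add: D_def)
      qed
      then show ?thesis by (simp add: F_def)
    qed
    have near: "\<bar>steps_op k ws F x - R\<bar> \<le> C * \<eta>"
      unfolding F_def D_def R_def using \<beta> by (intro IH[unfolded sieve_error_def, rule_format, OF *(1) bspec[OF *(2)]] *(3)) auto
    have "\<bar>steps_op k ws (\<lambda>z. F z * D p z) x - steps_op k ws F x / real p ^ card {1..<k}\<bar>
             \<le> card {1..<k} * (p * N * \<eta>)"
      unfolding D_def by (rule steps_op_dvd_all[OF *(1) F1 inv _ _ cop p(2) *(3)]) auto
    then have "\<bar>steps_op k ws (\<lambda>z. F z * D p z) x - steps_op k ws F x / real p ^ (k - 1)\<bar>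
             \<le> real (k - 1) * (p * N * \<eta>)" by simp
    moreover have "\<bar>steps_op k ws F x / real p ^ (k - 1) - R / real p ^ (k - 1)\<bar> \<le> C * \<eta>"
    proof -
      have "1 \<le> real p ^ (k - 1)" using p by (intro one_le_power) auto
      have "\<bar>steps_op k ws F x / real p ^ (k - 1) - R / real p ^ (k - 1)\<bar> = \<bar>steps_op k ws F x - R\<bar> / real p ^ (k - 1)"
        by (simp flip: diff_divide_distrib)
      also have "\<dots> \<le> \<bar>steps_op k ws F x - R\<bar> / 1"
        using \<open>1 \<le> real p ^ (k - 1)\<close> p(2) by (intro divide_left_mono) auto
      finally show ?thesis using near by simp
    qed
    ultimately have "\<bar>steps_op k ws (\<lambda>z. F z * D p z) x - R / real p ^ (k - 1)\<bar>
        \<le> real (k - 1) * (p * N * \<eta>) + C * \<eta>" by linarith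
    then have "\<beta> p * \<bar>steps_op k ws (\<lambda>z. F z * D p z) x - R / real p ^ (k - 1)\<bar>
        \<le> 1 * (real (k - 1) * (p * N * \<eta>) + C * \<eta>)"
      using \<beta> C *(3) by (intro mult_mono) auto
    then have far: "\<bar>\<beta> p * steps_op k ws (\<lambda>z. F z * D p z) x - \<beta> p * (R / real p ^ (k - 1))\<bar>
        \<le> real (k - 1) * (p * N * \<eta>) + C * \<eta>"
      unfolding right_diff_distrib[symmetric] abs_mult using \<beta> by simp
    have tri: "\<bar>(a - b) - (r - e)\<bar> \<le> u + v" if "\<bar>a - r\<bar> \<le> u" "\<bar>b - e\<bar> \<le> v" for a b r e u v :: real
      using that by linarith
    have "(\<lambda>z. \<Prod>q\<in>insert p Q. 1 - \<beta> q * D q z) = (\<lambda>z. F z - \<beta> p * (F z * D p z))"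
      using insert by (simp add: F_def algebra_simps)
    moreover have "(\<Prod>q\<in>insert p Q. 1 - \<beta> q / real q ^ (k - 1)) = R - \<beta> p * (R / real p ^ (k - 1))"
      using insert by (simp add: R_def algebra_simps)
    moreover have "K * \<eta> = C * \<eta> + (real (k - 1) * (p * N * \<eta>) + C * \<eta>)"
      by (simp add: K_def algebra_simps)
    ultimately have "\<bar>steps_op k ws (\<lambda>z. \<Prod>q\<in>insert p Q. 1 - \<beta> q * D q z) x
        - (\<Prod>q\<in>insert p Q. 1 - \<beta> q / real q ^ (k - 1))\<bar> \<le> K * \<eta>"
      using tri[OF near far] by (simp only: steps_op_diff steps_op_cmult)
    then show "\<bar>steps_op k ws (\<lambda>z. \<Prod>p\<in>insert p Q. 1 - \<beta> p * (\<Prod>j\<in>{1..<k}. of_bool (int p dvd z j + b p j))) x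
        - (\<Prod>p\<in>insert p Q. 1 - \<beta> p / real p ^ (k - 1))\<bar> \<le> K * \<eta>"
      unfolding D_def .
  qed
  moreover have "0 \<le> K" using C by (simp add: K_def)
  ultimately show ?case by blast
qed

section \<open>Visibility and prime divisors\<close>

lemma not_visible_iff: "\<not> visible k z \<longleftrightarrow> (\<exists>p::nat. prime p \<and> (\<forall>j<k. int p dvd z j))"
proof
  assume "\<not> visible k z"
  then have "nat (Gcd (z ` {..<k})) \<noteq> 1" by (auto simp: visible_def)
  then obtain p where p: "prime p" "p dvd nat (Gcd (z ` {..<k}))" using prime_factor_nat by blast
  have "int p dvd Gcd (z ` {..<k})" using p(2) by (simp flip: int_dvd_int_iff)
  then have "\<forall>j<k. int p dvd z j" by (auto simp: dvd_Gcd_iff)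
  then show "\<exists>p::nat. prime p \<and> (\<forall>j<k. int p dvd z j)" using p(1) by blast
next
  assume "\<exists>p::nat. prime p \<and> (\<forall>j<k. int p dvd z j)"
  then obtain p :: nat where p: "prime p" "\<forall>j<k. int p dvd z j" by blast
  then have "int p dvd Gcd (z ` {..<k})" by (auto simp: dvd_Gcd_iff)
  then show "\<not> visible k z" using p(1) by (auto simp: visible_def)
qed

text \<open>The first coordinate equals the known sum minus the others, so its divisibility follows
  from theirs and that of \<open>i\<close>.\<close>

lemma dvd_all_coordinates_iff:
  fixes k i p :: nat and z :: "nat \<Rightarrow> int"
  assumes "k \<ge> 1" "(\<Sum>j<k. z j) = int i"
  shows "(\<forall>j<k. int p dvd z j) \<longleftrightarrow> p dvd i \<and> (\<forall>j\<in>{1..<k}. int p dvd z j)"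
proof
  assume *: "\<forall>j<k. int p dvd z j"
  then have "int p dvd (\<Sum>j<k. z j)" by (intro dvd_sum) auto
  then show "p dvd i \<and> (\<forall>j\<in>{1..<k}. int p dvd z j)" using * assms by simp
next
  assume *: "p dvd i \<and> (\<forall>j\<in>{1..<k}. int p dvd z j)"
  have "{..<k} = insert 0 {1..<k}" using assms(1) by auto
  then have "z 0 = int i - (\<Sum>j\<in>{1..<k}. z j)" using assms(2) by simp
  moreover have "int p dvd (\<Sum>j\<in>{1..<k}. z j)" using * by (intro dvd_sum) auto
  ultimately have "int p dvd z 0" using * by auto
  then show "\<forall>j<k. int p dvd z j" using * by (metis Suc_leI atLeastLessThan_iff One_nat_def gr0I)
qed

definition vis :: "nat \<Rightarrow> (nat \<Rightarrow> int) \<Rightarrow> real" where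
  "vis k z = of_bool (visible k z)"

text \<open>The heuristic probability that no prime in \<open>Q\<close> divides either point: a
  prime can act only when it divides \<open>i\<close> or \<open>i + 1\<close>, and then
  \<open>k - 1\<close> coordinates are free modulo \<open>p\<close>.\<close>

definition sieve_mean :: "nat \<Rightarrow> nat set \<Rightarrow> nat \<Rightarrow> real" where
  "sieve_mean k Q i = (\<Prod>p\<in>Q. 1 - of_bool (p dvd i \<or> p dvd Suc i) / real p ^ (k - 1))"

text \<open>Bounds the probability that some \<open>d > P\<close> divides the position at time \<open>i\<close>.\<close>

definition tail :: "nat \<Rightarrow> real \<Rightarrow> nat \<Rightarrow> real" where
  "tail P \<kappa> i = (\<Sum>d\<in>{d\<in>{P<..i}. d dvd i}. 1 / real d + \<kappa>)"

lemma prod_of_bool: "finite A \<Longrightarrow> (\<Prod>a\<in>A. of_bool (P a)) = (of_bool (\<forall>a\<in>A. P a) :: real)"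
  by (induction A rule: finite_induct) auto

text \<open>As \<open>p\<close> cannot divide both \<open>i\<close> and \<open>i + 1\<close>, it excludes at most one of the two points, and the offset in the inner product selects which.\<close>

lemma visible_pair_sieve:
  assumes k: "k \<ge> 1" and l: "l < k" and z: "(\<Sum>j<k. z j) = int i" and Q: "finite Q" "\<forall>p\<in>Q. prime p"
  shows "(\<Prod>p\<in>Q. 1 - of_bool (p dvd i \<or> p dvd Suc i) *
             (\<Prod>j\<in>{1..<k}. of_bool (int p dvd z j + (if p dvd i then 0 else unit_vec l j))))
       = (of_bool (\<forall>p\<in>Q. \<not> (\<forall>j<k. int p dvd z j) \<and> \<not> (\<forall>j<k. int p dvd (z + unit_vec l) j)) :: real)"
proof -
  have z': "(\<Sum>j<k. (z + unit_vec l) j) = int (Suc i)" using z l by (simp add: sum_add_unit_vec)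
  have "1 - of_bool (p dvd i \<or> p dvd Suc i) *
             (\<Prod>j\<in>{1..<k}. of_bool (int p dvd z j + (if p dvd i then 0 else unit_vec l j)))
      = (of_bool (\<not> (\<forall>j<k. int p dvd z j) \<and> \<not> (\<forall>j<k. int p dvd (z + unit_vec l) j)) :: real)"
    if "p \<in> Q" for p
  proof -
    have "\<not> (p dvd i \<and> p dvd Suc i)"
      using Q(2) that by (metis coprime_Suc_right_nat coprime_common_divisor_nat not_prime_1)
    then show ?thesis
      unfolding dvd_all_coordinates_iff[OF k z] dvd_all_coordinates_iff[OF k z']
      by (auto simp: prod_of_bool plus_fun_apply)
  qed
  then show ?thesis by (simp add: prod_of_bool[OF Q(1)])
qed

text \<open>Sieving only up to \<open>P\<close> overcounts just the pairs excluded by a prime above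
  \<open>P\<close>. Such a prime divides the time and the first coordinate of the point, so a union
  bound over all divisors \<open>d > P\<close> of the time controls the excess.\<close>

lemma visible_pair_bounds:
  fixes P :: nat
  assumes k: "k \<ge> 1" and l: "l < k" and z: "(\<Sum>j<k. z j) = int i" and i: "i > 0"
  defines "B \<equiv> \<forall>p\<in>{p. prime p \<and> p \<le> P}. \<not> (\<forall>j<k. int p dvd z j) \<and> \<not> (\<forall>j<k. int p dvd (z + unit_vec l) j)"
  shows "vis k z * vis k (z + unit_vec l) \<le> of_bool B"
    and "of_bool B \<le> vis k z * vis k (z + unit_vec l)
          + ((\<Sum>d\<in>{d\<in>{P<..i}. d dvd i}. of_bool (int d dvd z 0 + 0))
          + (\<Sum>d\<in>{d\<in>{P<..Suc i}. d dvd Suc i}. of_bool (int d dvd z 0 + unit_vec l 0)))"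
proof -
  have z': "(\<Sum>j<k. (z + unit_vec l) j) = int (Suc i)" using z l by (simp add: sum_add_unit_vec)
  show "vis k z * vis k (z + unit_vec l) \<le> of_bool B"
    unfolding vis_def B_def using not_visible_iff[of k z] not_visible_iff[of k "z + unit_vec l"]
    by (auto simp: of_bool_def)
  have big: "1 \<le> (\<Sum>d\<in>{d\<in>{P<..n}. d dvd n}. of_bool (int d dvd y 0) :: real)"
    if y: "(\<Sum>j<k. y j) = int n" "n > 0" "\<not> visible k y"
      "\<forall>p\<in>{p. prime p \<and> p \<le> P}. \<not> (\<forall>j<k. int p dvd y j)" for y n
  proof -
    obtain p where p: "prime p" "\<forall>j<k. int p dvd y j" using y(3) not_visible_iff by blast
    then have "p dvd n" using dvd_all_coordinates_iff[OF k y(1)] by blast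
    moreover have "P < p" using p y(4) by (metis (mono_tags, lifting) mem_Collect_eq not_le)
    ultimately have "p \<in> {d\<in>{P<..n}. d dvd n}" using y(2) by (auto dest: dvd_imp_le)
    then have "of_bool (int p dvd y 0) \<le> (\<Sum>d\<in>{d\<in>{P<..n}. d dvd n}. of_bool (int d dvd y 0) :: real)"
      by (intro member_le_sum) auto
    then show ?thesis using p(2) k by auto
  qed
  have n1: "0 \<le> (\<Sum>d\<in>{d\<in>{P<..i}. d dvd i}. of_bool (int d dvd z 0 + 0) :: real)"
    and n2: "0 \<le> (\<Sum>d\<in>{d\<in>{P<..Suc i}. d dvd Suc i}. of_bool (int d dvd z 0 + unit_vec l 0) :: real)"
    by (auto intro!: sum_nonneg)
  show "of_bool B \<le> vis k z * vis k (z + unit_vec l)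
          + ((\<Sum>d\<in>{d\<in>{P<..i}. d dvd i}. of_bool (int d dvd z 0 + 0))
          + (\<Sum>d\<in>{d\<in>{P<..Suc i}. d dvd Suc i}. of_bool (int d dvd z 0 + unit_vec l 0)))"
  proof (cases "B \<and> \<not> (visible k z \<and> visible k (z + unit_vec l))")
    case True
    then consider "\<not> visible k z" | "\<not> visible k (z + unit_vec l)" by blast
    then have "1 \<le> (\<Sum>d\<in>{d\<in>{P<..i}. d dvd i}. of_bool (int d dvd z 0 + 0))
          + (\<Sum>d\<in>{d\<in>{P<..Suc i}. d dvd Suc i}. of_bool (int d dvd z 0 + unit_vec l 0) :: real)"
    proof cases
      case 1
      then show ?thesis using big[OF z i 1] True n2 by (simp add: B_def)
    next
      case 2
      then show ?thesis using big[OF z' _ 2] True n1 by (simp add: B_def plus_fun_apply)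
    qed
    then show ?thesis using True by (auto simp: vis_def)
  next
    case False
    then show ?thesis using n1 n2 by (auto simp: vis_def of_bool_def)
  qed
qed

definition pair_error :: "nat \<Rightarrow> nat \<Rightarrow> real \<Rightarrow> bool" where
  "pair_error k P C \<longleftrightarrow> (\<forall>c ws \<eta> x i l. flat k \<eta> ws \<longrightarrow> (\<forall>w\<in>set ws. weights k c w) \<longrightarrow> c \<ge> 0 \<longrightarrow> \<eta> > 0 \<longrightarrow>
     l < k \<longrightarrow> (\<Sum>j<k. x j) + int (length ws) = int i \<longrightarrow> i > 0 \<longrightarrow>
     \<bar>steps_op k ws (\<lambda>z. vis k z * vis k (z + unit_vec l)) x - sieve_mean k {p. prime p \<and> p \<le> P} i\<bar>
       \<le> C * \<eta> + tail P (3 * sqrt \<eta>) i + tail P (3 * sqrt \<eta>) (Suc i))"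

text \<open>The sieve by primes up to \<open>P\<close> bounds the pair from above, and the divisor
  sums bound the loss. The constant is independent of \<open>ws\<close> and \<open>x\<close>, which
  makes the estimate uniform in the past of the walk.\<close>

lemma steps_op_visible_pair:
  assumes k: "k \<ge> 2"
  shows "\<exists>C\<ge>0. pair_error k P C"
proof -
  let ?Q = "{p::nat. prime p \<and> p \<le> P}"
  have Q: "finite ?Q" "\<forall>p\<in>?Q. prime p" by auto
  obtain C where C: "C \<ge> 0" and sieve: "sieve_error k ?Q C"
    using steps_op_sieve[OF Q, of k] by blast
  have "pair_error k P C"
    unfolding pair_error_def
  proof (intro allI impI)
    fix c ws \<eta> x i l
    assume flat: "flat k \<eta> ws" and w: "\<forall>w\<in>set ws. weights k c w" "c \<ge> 0" and \<eta>: "\<eta> > 0"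
      and l: "l < k" and x: "(\<Sum>j<k. x j) + int (length ws) = int i" and i: "i > 0"
    define F where "F = (\<lambda>z. \<Prod>p\<in>?Q. 1 - of_bool (p dvd i \<or> p dvd Suc i) *
             (\<Prod>j\<in>{1..<k}. of_bool (int p dvd z j + (if p dvd i then 0 else unit_vec l j))) :: real)"
    define V where "V = (\<lambda>z. vis k z * vis k (z + unit_vec l))"
    define Z where "Z n b = (\<lambda>z::nat \<Rightarrow> int. \<Sum>d\<in>{d\<in>{P<..n}. d dvd n}. of_bool (int d dvd z 0 + b) :: real)" for n b
    have F: "\<bar>steps_op k ws F x - sieve_mean k ?Q i\<bar> \<le> C * \<eta>"
      unfolding F_def sieve_mean_def using \<eta> by (intro sieve[unfolded sieve_error_def, rule_format, OF flat bspec[OF w(1)]]) auto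
    have Z: "steps_op k ws (Z n b) x \<le> tail P (3 * sqrt \<eta>) n" for n b
      unfolding Z_def tail_def steps_op_sum
      by (intro sum_mono steps_op_dvd_le_sqrt[OF flat w k _ \<eta>]) auto
    have k1: "k \<ge> 1" using k by simp
    have FB: "V z \<le> F z \<and> F z \<le> V z + (Z i 0 z + Z (Suc i) (unit_vec l 0) z)"
      if "(\<Sum>j<k. z j) = (\<Sum>j<k. x j) + int (length ws)" for z
    proof -
      have z: "(\<Sum>j<k. z j) = int i" using that x by simp
      show ?thesis
        unfolding F_def visible_pair_sieve[OF k1 l z Q] V_def Z_def
        using visible_pair_bounds[OF k1 l z i, of P] by blast
    qed
    have lower: "steps_op k ws V x \<le> steps_op k ws F x"
      using FB by (intro steps_op_mono[OF w]) auto
    have "steps_op k ws F x \<le> steps_op k ws (\<lambda>z. V z + (Z i 0 z + Z (Suc i) (unit_vec l 0) z)) x"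
      using FB by (intro steps_op_mono[OF w]) auto
    also have "\<dots> \<le> steps_op k ws V x + (tail P (3 * sqrt \<eta>) i + tail P (3 * sqrt \<eta>) (Suc i))"
      unfolding steps_op_add using Z by (intro add_mono) auto
    finally have upper: "steps_op k ws F x \<le> \<dots>" .
    have tail: "0 \<le> tail P (3 * sqrt \<eta>) n" for n
      unfolding tail_def using \<eta> by (intro sum_nonneg) auto
    have arith: "\<bar>v - r\<bar> \<le> e + s + t"
      if "v \<le> f" "f \<le> v + (s + t)" "0 \<le> s" "0 \<le> t" "\<bar>f - r\<bar> \<le> e" for v r e s t f :: real
      using that by linarith
    show "\<bar>steps_op k ws (\<lambda>z. vis k z * vis k (z + unit_vec l)) x - sieve_mean k ?Q i\<bar>
       \<le> C * \<eta> + tail P (3 * sqrt \<eta>) i + tail P (3 * sqrt \<eta>) (Suc i)"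
      using arith[OF lower upper tail tail F] by (simp only: V_def)
  qed
  with C show ?thesis by blast
qed

section \<open>Averages over time\<close>

lemma sum_shift_bound:
  fixes g :: "nat \<Rightarrow> real"
  assumes "\<And>i. 0 \<le> g i" "\<And>i. g i \<le> 1"
  shows "\<bar>(\<Sum>i=1..n. g (i + t)) - (\<Sum>i=1..n. g i)\<bar> \<le> t"
proof (induction t)
  case (Suc t)
  have "(\<Sum>i=1..n. g (i + Suc t)) - (\<Sum>i=1..n. g (i + t)) = g (n + 1 + t) - g (1 + t)"
    by (induction n) (auto simp: algebra_simps)
  then have "\<bar>(\<Sum>i=1..n. g (i + Suc t)) - (\<Sum>i=1..n. g (i + t))\<bar> \<le> 1"
    using assms[of "n + 1 + t"] assms[of "1 + t"] by linarith
  then show ?case using Suc by simp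
qed simp

text \<open>Primes are added one at a time: \<open>f\<close> has period \<open>N\<close>, and among
  \<open>p\<close> shifts by multiples of \<open>N\<close> exactly one makes \<open>p\<close> divide
  \<open>i\<close> and a different one makes \<open>p\<close> divide \<open>i + 1\<close>. So the
  new prime is active for a proportion \<open>2 / p\<close> of the times, independently of the
  others.\<close>

lemma mean_prod_dvd:
  fixes Q :: "nat set" and \<beta> :: "nat \<Rightarrow> real"
  assumes "finite Q" "\<forall>p\<in>Q. prime p" "\<forall>p\<in>Q. 0 \<le> \<beta> p \<and> \<beta> p \<le> 1"
  shows "(\<lambda>n. (\<Sum>i=1..n. \<Prod>p\<in>Q. 1 - of_bool (p dvd i \<or> p dvd Suc i) * \<beta> p) / n)
            \<longlonglongrightarrow> (\<Prod>p\<in>Q. 1 - 2 * \<beta> p / p)"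
  using assms
proof (induction Q rule: finite_induct)
  case empty
  have "eventually (\<lambda>n. real n / real n = 1) sequentially"
    using eventually_gt_at_top[of "0::nat"] by eventually_elim simp
  then show ?case by (auto intro: tendsto_eventually)
next
  case (insert p Q)
  define f where "f i = (\<Prod>q\<in>Q. 1 - of_bool (q dvd i \<or> q dvd Suc i) * \<beta> q)" for i
  define g where "g i = f i * of_bool (p dvd i \<or> p dvd Suc i)" for i
  define N where "N = \<Prod>Q"
  have p: "prime p" "p > 0" "p \<ge> 2" using insert.prems prime_gt_0_nat prime_ge_2_nat by auto
  have cop: "coprime N p"
    unfolding N_def using insert by (intro prod_coprime_left) (metis insert_iff primes_coprime)
  have \<beta>: "0 \<le> \<beta> q" "\<beta> q \<le> 1" if "q \<in> Q" for q using insert.prems that by auto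
  have f01: "0 \<le> f i" "f i \<le> 1" for i
    unfolding f_def using \<beta> by (auto intro!: prod_nonneg prod_le_1)
  have g01: "0 \<le> g i" "g i \<le> 1" for i using f01[of i] by (auto simp: g_def)
  have fper: "f (i + N * s) = f i" for i s
  proof -
    have "q dvd i + N * s \<longleftrightarrow> q dvd i" "q dvd Suc (i + N * s) \<longleftrightarrow> q dvd Suc i" if "q \<in> Q" for q
    proof -
      have "q dvd N * s" unfolding N_def using dvd_prodI[OF insert.hyps(1) that, of "\<lambda>x. x"] by auto
      then show "q dvd i + N * s \<longleftrightarrow> q dvd i" "q dvd Suc (i + N * s) \<longleftrightarrow> q dvd Suc i"
        using dvd_add_left_iff[of q "N * s"] by (auto simp flip: add_Suc)
    qed
    then show ?thesis by (simp add: f_def)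
  qed
  have hits: "(\<Sum>s<p. of_bool (p dvd i + N * s)) = (1::real)" for i
    using sum_of_bool_dvd_eq_1[OF cop p(2), of "int i"] by (simp flip: of_nat_mult of_nat_add)
  have not_both: "\<not> (p dvd i \<and> p dvd Suc i)" for i
    using p(1) by (metis coprime_Suc_right_nat coprime_common_divisor_nat not_prime_1)
  have gsum: "(\<Sum>s<p. g (i + N * s)) = 2 * f i" for i
  proof -
    have "g (i + N * s) = f i * of_bool (p dvd i + N * s) + f i * of_bool (p dvd Suc i + N * s)" for s
      using not_both[of "i + N * s"] by (auto simp: g_def fper)
    then have "(\<Sum>s<p. g (i + N * s))
        = f i * (\<Sum>s<p. of_bool (p dvd i + N * s)) + f i * (\<Sum>s<p. of_bool (p dvd Suc i + N * s))"
      by (simp only: sum.distrib sum_distrib_left)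
    then show ?thesis by (simp only: hits)
  qed
  have IH: "(\<lambda>n. (\<Sum>i=1..n. f i) / n) \<longlonglongrightarrow> (\<Prod>q\<in>Q. 1 - 2 * \<beta> q / q)"
    unfolding f_def using insert by auto
  \<comment> \<open>Averaging over the \<open>p\<close> shifts costs only boundary terms, bounded
    independently of \<open>n\<close>.\<close>
  have close: "\<bar>(\<Sum>i=1..n. g i) - 2 / p * (\<Sum>i=1..n. f i)\<bar> \<le> p * N" for n
  proof -
    have "2 * (\<Sum>i=1..n. f i) = (\<Sum>s<p. \<Sum>i=1..n. g (i + N * s))"
      unfolding sum_distrib_left gsum[symmetric] by (rule sum.swap)
    then have "p * (\<Sum>i=1..n. g i) - 2 * (\<Sum>i=1..n. f i)
                 = (\<Sum>s<p. (\<Sum>i=1..n. g i) - (\<Sum>i=1..n. g (i + N * s)))"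
      by (simp add: sum_subtractf)
    also have "\<bar>\<dots>\<bar> \<le> (\<Sum>s<p. real (p * N))"
    proof (intro order_trans[OF sum_abs] sum_mono)
      fix s assume "s \<in> {..<p}"
      then have "real (N * s) \<le> real (p * N)" by (auto simp flip: of_nat_mult)
      then show "\<bar>(\<Sum>i=1..n. g i) - (\<Sum>i=1..n. g (i + N * s))\<bar> \<le> real (p * N)"
        using sum_shift_bound[of g "N * s" n, OF g01] by linarith
    qed
    finally have "\<bar>p * ((\<Sum>i=1..n. g i) - 2 / p * (\<Sum>i=1..n. f i))\<bar> \<le> p * (p * N)"
      using p(2) by (simp add: right_diff_distrib)
    then show ?thesis using p(2) by (simp add: abs_mult)
  qed
  have "(\<lambda>n. (\<Sum>i=1..n. g i) / n - 2 / p * ((\<Sum>i=1..n. f i) / n)) \<longlonglongrightarrow> 0"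
  proof (rule Lim_null_comparison)
    show "\<forall>\<^sub>F n in sequentially. norm ((\<Sum>i=1..n. g i) / n - 2 / p * ((\<Sum>i=1..n. f i) / n)) \<le> real (p * N) / real n"
    proof (intro always_eventually allI)
      fix n
      have "(\<Sum>i=1..n. g i) / n - 2 / p * ((\<Sum>i=1..n. f i) / n)
              = ((\<Sum>i=1..n. g i) - 2 / p * (\<Sum>i=1..n. f i)) / n" by (simp add: diff_divide_distrib)
      then show "norm ((\<Sum>i=1..n. g i) / n - 2 / p * ((\<Sum>i=1..n. f i) / n)) \<le> real (p * N) / real n"
        using close[of n] by (simp add: abs_divide divide_right_mono)
    qed
    show "(\<lambda>n. real (p * N) / real n) \<longlonglongrightarrow> 0" by (rule lim_const_over_n)
  qed
  from tendsto_add[OF this tendsto_mult[OF tendsto_const[of "2 / real p"] IH]]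
  have G: "(\<lambda>n. (\<Sum>i=1..n. g i) / n) \<longlonglongrightarrow> 2 / p * (\<Prod>q\<in>Q. 1 - 2 * \<beta> q / q)" by simp
  have "(\<Prod>q\<in>insert p Q. 1 - of_bool (q dvd i \<or> q dvd Suc i) * \<beta> q) = f i - \<beta> p * g i" for i
    using insert by (simp add: f_def g_def algebra_simps)
  then have "(\<lambda>n. (\<Sum>i=1..n. \<Prod>q\<in>insert p Q. 1 - of_bool (q dvd i \<or> q dvd Suc i) * \<beta> q) / n)
     = (\<lambda>n. (\<Sum>i=1..n. f i) / n - \<beta> p * ((\<Sum>i=1..n. g i) / n))"
    by (simp add: sum_subtractf diff_divide_distrib flip: sum_distrib_left)
  moreover have "(\<Prod>q\<in>insert p Q. 1 - 2 * \<beta> q / q)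
     = (\<Prod>q\<in>Q. 1 - 2 * \<beta> q / q) - \<beta> p * (2 / p * (\<Prod>q\<in>Q. 1 - 2 * \<beta> q / q))"
    using insert by (simp add: algebra_simps)
  ultimately show ?case
    using tendsto_diff[OF IH tendsto_mult[OF tendsto_const[of "\<beta> p"] G]] by simp
qed

text \<open>A prime acts with weight \<open>1 / p ^ (k - 1)\<close> for a proportion
  \<open>2 / p\<close> of the times, which yields \<open>2 / p ^ k\<close>.\<close>

lemma mean_sieve_mean:
  assumes "finite Q" "\<forall>p\<in>Q. prime p" "k \<ge> 1"
  shows "(\<lambda>n. (\<Sum>i=1..n. sieve_mean k Q i) / n) \<longlonglongrightarrow> (\<Prod>p\<in>Q. 1 - 2 / real p ^ k)"
proof -
  have "1 \<le> real p ^ (k - 1)" if "p \<in> Q" for p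
    using assms(2) that prime_gt_0_nat by (intro one_le_power) (auto simp: Suc_le_eq)
  then have "0 \<le> 1 / real p ^ (k - 1) \<and> 1 / real p ^ (k - 1) \<le> 1" if "p \<in> Q" for p
    by (simp only: divide_le_eq_1) (use that in force)
  then have "(\<lambda>n. (\<Sum>i=1..n. sieve_mean k Q i) / n) \<longlonglongrightarrow> (\<Prod>p\<in>Q. 1 - 2 * (1 / real p ^ (k - 1)) / p)"
    using mean_prod_dvd[OF assms(1,2), of "\<lambda>p. 1 / real p ^ (k - 1)"] by (simp add: sieve_mean_def)
  also have "(\<Prod>p\<in>Q. 1 - 2 * (1 / real p ^ (k - 1)) / p) = (\<Prod>p\<in>Q. 1 - 2 / real p ^ k)"
    using assms(3) by (intro prod.cong) (auto simp: power_eq_if)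
  finally show ?thesis .
qed

section \<open>The contribution of large divisors on average over time\<close>

lemma card_multiples_le:
  fixes n d :: nat
  shows "real (card {i\<in>{1..n}. d dvd i}) \<le> n / d"
proof (cases "d = 0")
  case False
  have "{i\<in>{1..n}. d dvd i} \<subseteq> (\<lambda>j. d * j) ` {1..n div d}"
  proof
    fix i assume "i \<in> {i\<in>{1..n}. d dvd i}"
    then obtain j where j: "i = d * j" "d * j \<in> {1..n}" by auto
    then have "j \<in> {1..n div d}"
      using False by (auto simp: less_eq_div_iff_mult_less_eq mult.commute Suc_le_eq)
    then show "i \<in> (\<lambda>j. d * j) ` {1..n div d}" using j(1) by blast
  qed
  then have "card {i\<in>{1..n}. d dvd i} \<le> card ((\<lambda>j. d * j) ` {1..n div d})"
    by (intro card_mono) auto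
  also have "\<dots> \<le> n div d" using card_image_le[of "{1..n div d}" "\<lambda>j. d * j"] by simp
  finally have "real (card {i\<in>{1..n}. d dvd i}) \<le> real (n div d)" by simp
  also have "\<dots> \<le> n / d" by (rule of_nat_div_le_of_nat)
  finally show ?thesis .
qed auto

text \<open>Comparison with the telescoping differences \<open>1 / n - 1 / Suc n\<close>.\<close>

lemma sum_inverse_squares_le:
  assumes "P \<ge> 1" "n \<ge> P"
  shows "(\<Sum>d\<in>{P<..n}. 1 / (real d)\<^sup>2) \<le> 1 / P - 1 / n"
  using assms(2)
proof (induction n rule: dec_induct)
  case (step n)
  have "n > 0" using step assms by simp
  have "{P<..Suc n} = insert (Suc n) {P<..n}" using step by auto
  moreover have "1 / (real (Suc n))\<^sup>2 \<le> 1 / n - 1 / Suc n"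
  proof -
    have "1 / (real (Suc n))\<^sup>2 \<le> 1 / (real n * real (Suc n))"
      using \<open>n > 0\<close> by (intro divide_left_mono) (auto simp: power2_eq_square)
    also have "\<dots> = 1 / n - 1 / Suc n" using \<open>n > 0\<close> by (simp add: field_simps)
    finally show ?thesis .
  qed
  ultimately show ?case using step.IH by simp
qed simp

text \<open>After exchanging the sums, each \<open>d\<close> has at most \<open>n / d\<close>
  multiples. The main part becomes a tail of inverse squares; the error part becomes a harmonic sum,
  whose logarithm is later absorbed by the decay of \<open>\<kappa>\<close>.\<close>

lemma sum_tail_le:
  assumes P: "P \<ge> 1" and \<kappa>: "\<kappa> \<ge> 0" and n: "n \<ge> 1"
  shows "(\<Sum>i=1..n. tail P \<kappa> i) \<le> n / P + \<kappa> * n * (1 + ln n)"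
proof -
  have "(\<Sum>i=1..n. tail P \<kappa> i) = (\<Sum>i=1..n. \<Sum>d\<in>{P<..n}. of_bool (d dvd i) * (1 / real d + \<kappa>))"
  proof (rule sum.cong)
    fix i assume i: "i \<in> {1..n}"
    have "{d\<in>{P<..i}. d dvd i} = {P<..n} \<inter> {d. d dvd i}" using i by (auto dest: dvd_imp_le)
    then show "tail P \<kappa> i = (\<Sum>d\<in>{P<..n}. of_bool (d dvd i) * (1 / real d + \<kappa>))"
      by (simp add: tail_def of_bool_def if_distrib[of "\<lambda>x. x * _"] sum.inter_restrict
          cong: if_cong)
  qed simp
  also have "\<dots> = (\<Sum>d\<in>{P<..n}. real (card {i\<in>{1..n}. d dvd i}) * (1 / real d + \<kappa>))"
    by (subst sum.swap) (simp add: Int_def flip: sum_distrib_right)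
  also have "\<dots> \<le> (\<Sum>d\<in>{P<..n}. n / d * (1 / real d + \<kappa>))"
    using \<kappa> by (intro sum_mono mult_right_mono card_multiples_le) auto
  also have "\<dots> = n * (\<Sum>d\<in>{P<..n}. 1 / (real d)\<^sup>2) + \<kappa> * n * (\<Sum>d\<in>{P<..n}. 1 / real d)"
    by (simp add: sum_distrib_left power2_eq_square algebra_simps flip: sum.distrib)
  also have "\<dots> \<le> n * (1 / P) + \<kappa> * n * (1 + ln n)"
  proof (intro add_mono mult_left_mono)
    show "(\<Sum>d\<in>{P<..n}. 1 / (real d)\<^sup>2) \<le> 1 / P"
    proof (cases "n \<ge> P")
      case True
      have "0 \<le> 1 / real n" by simp
      then show ?thesis using sum_inverse_squares_le[OF P True] by linarith
    qed auto
    have "(\<Sum>d\<in>{P<..n}. 1 / real d) \<le> (\<Sum>d\<in>{1..n}. 1 / real d)"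
      by (intro sum_mono2) auto
    also have "\<dots> = harm n" by (simp add: harm_def inverse_eq_divide)
    also have "\<dots> \<le> 1 + ln n"
    proof -
      obtain m where "n = Suc m" using n by (cases n) auto
      \<comment> \<open>The difference of \<open>harm\<close> and \<open>ln\<close> decreases from
        its value 1 at index 1.\<close>
      then show ?thesis using decseqD[OF decseq_harm_diff_ln, of 0 m] by (simp add: harm_def)
    qed
    finally show "(\<Sum>d\<in>{P<..n}. 1 / real d) \<le> 1 + ln n" .
  qed (use \<kappa> in auto)
  finally show ?thesis by simp
qed

section \<open>Convergence of the product over the primes\<close>

lemma prime_product_tendsto:
  assumes k: "k \<ge> 2"
  shows "(\<lambda>P. \<Prod>p\<in>{p. prime p \<and> p \<le> P}. 1 - 2 / real p ^ k)
           \<longlonglongrightarrow> (\<Prod>p. if prime p then 1 - 2 / real p ^ k else 1)"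
proof -
  define f :: "nat \<Rightarrow> real" where "f p = (if prime p then - 2 / real p ^ k else 0)" for p
  have ff: "(if prime p then 1 - 2 / real p ^ k else 1) = 1 + f p" for p by (simp add: f_def)
  have "convergent_prod (\<lambda>p. 1 + f p)"
  proof (rule summable_imp_convergent_prod_real)
    show "summable (\<lambda>p. \<bar>f p\<bar>)"
    proof (rule summable_comparison_test')
      show "summable (\<lambda>p. 2 * inverse (real p ^ k))" by (intro summable_mult inverse_power_summable k)
      show "norm \<bar>f p\<bar> \<le> 2 * inverse (real p ^ k)" if "p \<ge> 0" for p
        by (simp add: f_def inverse_eq_divide)
    qed
    \<comment> \<open>No factor vanishes: \<open>k \<ge> 2\<close> makes \<open>2 / p ^ k\<close> at
      most \<open>1 / 2\<close>.\<close>
    show "f p \<noteq> - 1" for p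
    proof (cases "prime p")
      case True
      then have "2 \<le> real p" using prime_ge_2_nat by fastforce
      then have "2 ^ 2 \<le> real p ^ 2" by (intro power_mono) auto
      also have "real p ^ 2 \<le> real p ^ k" using \<open>2 \<le> real p\<close> k by (intro power_increasing) auto
      finally show ?thesis by (simp add: f_def field_simps)
    qed (simp add: f_def)
  qed
  then have "(\<lambda>n. \<Prod>p\<le>n. 1 + f p) \<longlonglongrightarrow> (\<Prod>p. 1 + f p)" by (rule convergent_prod_LIMSEQ)
  moreover have "(\<Prod>p\<le>n. 1 + f p) = (\<Prod>p\<in>{p. prime p \<and> p \<le> n}. 1 - 2 / real p ^ k)" for n
  proof -
    have "(\<Prod>p\<le>n. 1 + f p) = (\<Prod>p\<in>{p. prime p \<and> p \<le> n}. 1 + f p)"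
      by (intro prod.mono_neutral_right) (auto simp: f_def)
    also have "\<dots> = (\<Prod>p\<in>{p. prime p \<and> p \<le> n}. 1 - 2 / real p ^ k)"
      by (intro prod.cong) (auto simp: f_def)
    finally show ?thesis .
  qed
  ultimately show ?thesis by (simp only: ff)
qed

section \<open>The law of large numbers\<close>

locale type_walk = prob_space M for M :: "'a measure" +
  fixes k q :: nat and alpha :: "nat \<Rightarrow> nat \<Rightarrow> real" and tp :: "nat \<Rightarrow> nat" and W :: "nat \<Rightarrow> 'a \<Rightarrow> nat"
  assumes k: "k \<ge> 2"
    and alpha_pos: "\<And>t j. t < q \<Longrightarrow> j < k \<Longrightarrow> 0 < alpha t j"
    and alpha_sum: "\<And>t. t < q \<Longrightarrow> (\<Sum>j<k. alpha t j) = 1"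
    and tp: "\<And>i. i \<ge> 1 \<Longrightarrow> tp i < q"
    and W_meas: "\<And>i. i \<ge> 1 \<Longrightarrow> W i \<in> measurable M (count_space UNIV)"
    and W_indep: "indep_vars (\<lambda>_. count_space UNIV) W {1..}"
    and W_prob: "\<And>i j. i \<ge> 1 \<Longrightarrow> j < k \<Longrightarrow> prob {\<omega> \<in> space M. W i \<omega> = j} = alpha (tp i) j"
begin

text \<open>Measurability with respect to the first \<open>a\<close> steps; for these discrete variables plain functional dependence suffices.\<close>

definition determined :: "nat \<Rightarrow> ('a \<Rightarrow> 'b) \<Rightarrow> bool" where
  "determined a Y \<longleftrightarrow> (\<forall>\<omega> \<omega>'. (\<forall>i\<in>{1..a}. W i \<omega> = W i \<omega>') \<longrightarrow> Y \<omega> = Y \<omega>')"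

lemma determined_mono: "determined a Y \<Longrightarrow> a \<le> b \<Longrightarrow> determined b Y"
  unfolding determined_def by (meson atLeastAtMost_iff order_trans)

lemma determined_walk_pos: "determined a (walk_pos W a)"
  unfolding determined_def
proof (intro allI impI ext)
  fix \<omega> \<omega>' j assume "\<forall>i\<in>{1..a}. W i \<omega> = W i \<omega>'"
  then have "{m \<in> {1..a}. W m \<omega> = j} = {m \<in> {1..a}. W m \<omega>' = j}" by (intro Collect_cong) auto
  then show "walk_pos W a \<omega> j = walk_pos W a \<omega>' j" by (simp add: walk_pos_def)
qed

lemma determined_comp: "determined a Y \<Longrightarrow> determined a (\<lambda>\<omega>. f (Y \<omega>))"
  unfolding determined_def by metis

lemma determined_comp2: "determined a Y \<Longrightarrow> determined a Z \<Longrightarrow> determined a (\<lambda>\<omega>. f (Y \<omega>) (Z \<omega>))"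
  unfolding determined_def by metis

text \<open>Choosing one representative for each value of the first \<open>a\<close> steps turns
  functional dependence into a composition.\<close>

lemma determined_factor:
  assumes "determined a Y"
  obtains F where "Y = F \<circ> (\<lambda>\<omega>. restrict (\<lambda>i. W i \<omega>) {1..a})"
proof
  define R where "R = (\<lambda>\<omega>. restrict (\<lambda>i. W i \<omega>) {1..a})"
  have "Y \<omega> = Y (SOME \<omega>'. R \<omega>' = R \<omega>)" for \<omega>
  proof -
    have "R (SOME \<omega>'. R \<omega>' = R \<omega>) = R \<omega>"
      using someI[of "\<lambda>\<omega>'. R \<omega>' = R \<omega>" \<omega>] by simp
    moreover have "\<forall>i\<in>{1..a}. W i \<omega>' = W i \<omega>" if "R \<omega>' = R \<omega>" for \<omega>'
    proof
      fix i assume "i \<in> {1..a}"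
      moreover have "R \<omega>' i = R \<omega> i" using that by simp
      ultimately show "W i \<omega>' = W i \<omega>" by (simp add: R_def)
    qed
    ultimately have "\<forall>i\<in>{1..a}. W i (SOME \<omega>'. R \<omega>' = R \<omega>) = W i \<omega>" by blast
    then show ?thesis using assms unfolding determined_def by metis
  qed
  then show "Y = (\<lambda>g. Y (SOME \<omega>'. R \<omega>' = g)) \<circ> (\<lambda>\<omega>. restrict (\<lambda>i. W i \<omega>) {1..a})"
    by (auto simp: R_def fun_eq_iff)
qed

text \<open>The first \<open>a\<close> steps take values in a countable discrete space, where every
  function is measurable; independence of blocks of steps therefore passes to
  \<open>Y\<close>.\<close>

lemma determined_indep:
  assumes "determined a (Y :: 'a \<Rightarrow> real)"
  shows "indep_var borel Y borel (\<lambda>\<omega>. f (W (Suc a) \<omega>) :: real)"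
proof -
  obtain F where F: "Y = F \<circ> (\<lambda>\<omega>. restrict (\<lambda>i. W i \<omega>) {1..a})"
    using determined_factor[OF assms] by blast
  have f: "(\<lambda>\<omega>. f (W (Suc a) \<omega>)) = (\<lambda>g. f (g (Suc a))) \<circ> (\<lambda>\<omega>. restrict (\<lambda>i. W i \<omega>) {Suc a})"
    by auto
  have "indep_var (PiM {1..a} (\<lambda>_. count_space UNIV)) (\<lambda>\<omega>. restrict (\<lambda>i. W i \<omega>) {1..a})
          (PiM {Suc a} (\<lambda>_. count_space UNIV)) (\<lambda>\<omega>. restrict (\<lambda>i. W i \<omega>) {Suc a})"
    by (rule indep_var_restrict[OF W_indep]) auto
  then show ?thesis
    unfolding F f
    by (rule indep_var_compose) (simp_all add: count_space_PiM_finite)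
qed

lemma determined_borel:
  assumes "determined a (Y :: 'a \<Rightarrow> real)"
  shows "Y \<in> borel_measurable M"
  using indep_var_rv1[OF determined_indep[OF assms, of "\<lambda>_. 0"]] .

lemma determined_integrable:
  assumes "determined a (Y :: 'a \<Rightarrow> real)" "\<And>\<omega>. \<bar>Y \<omega>\<bar> \<le> B"
  shows "integrable M Y"
  using assms by (intro integrable_const_bound[where B=B] determined_borel) auto

text \<open>The probabilities of the directions below \<open>k\<close> already sum to 1, so all
  other values of \<open>W i\<close> form a null event.\<close>

lemma AE_W_less: "i \<ge> 1 \<Longrightarrow> AE \<omega> in M. W i \<omega> < k"
proof -
  assume i: "i \<ge> 1"
  note [measurable] = W_meas[OF i]
  have "prob {\<omega> \<in> space M. W i \<omega> < k} = prob (\<Union>j<k. {\<omega> \<in> space M. W i \<omega> = j})"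
    by (intro arg_cong[where f=prob]) auto
  also have "\<dots> = (\<Sum>j<k. prob {\<omega> \<in> space M. W i \<omega> = j})"
    by (intro finite_measure_finite_Union) (auto simp: disjoint_family_on_def)
  also have "\<dots> = 1" using alpha_sum[OF tp[OF i]] W_prob[OF i] by simp
  finally have "AE \<omega> in M. \<omega> \<in> {\<omega> \<in> space M. W i \<omega> < k}" by (intro AE_prob_1)
  then show ?thesis by auto
qed

section \<open>The Markov property in integrated form\<close>

definition w :: "nat \<Rightarrow> nat \<Rightarrow> real" where "w i = alpha (tp i)"

text \<open>Split according to the value of step \<open>a + 1\<close>, which is independent of every
  \<open>Y l\<close>. Agreement of \<open>Z\<close> with \<open>Y\<close> for directions below
  \<open>k\<close> is agreement almost surely.\<close>

lemma expectation_step: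
  assumes Y: "\<And>l. l < k \<Longrightarrow> determined a (Y l)" "\<And>l \<omega>. \<bar>Y l \<omega>\<bar> \<le> B"
    and Z: "\<And>\<omega>. W (Suc a) \<omega> < k \<Longrightarrow> Z \<omega> = Y (W (Suc a) \<omega>) \<omega>" "determined (Suc a) Z"
  shows "expectation Z = expectation (\<lambda>\<omega>. \<Sum>l<k. w (Suc a) l * Y l \<omega> :: real)"
proof -
  note [measurable] = W_meas[of "Suc a", simplified] determined_borel[OF Y(1)]
  have ind: "integrable M (\<lambda>\<omega>. of_bool (W (Suc a) \<omega> = l) :: real)" for l
    by (intro integrable_const_bound[where B=1]) (auto simp: of_bool_def)
  have int: "integrable M (Y l)" if "l < k" for l
    using Y that by (intro determined_integrable[where B=B]) auto
  have indep: "indep_var borel (Y l) borel (\<lambda>\<omega>. of_bool (W (Suc a) \<omega> = l) :: real)" if "l < k" for l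
    using determined_indep[OF Y(1)[OF that], of "\<lambda>m. of_bool (m = l)"] .
  have int_mult: "integrable M (\<lambda>\<omega>. Y l \<omega> * of_bool (W (Suc a) \<omega> = l))" if "l < k" for l
    using indep_var_integrable[OF indep int ind] that by blast
  have "expectation Z = expectation (\<lambda>\<omega>. \<Sum>l<k. Y l \<omega> * of_bool (W (Suc a) \<omega> = l))"
  proof (rule integral_cong_AE)
    show "AE \<omega> in M. Z \<omega> = (\<Sum>l<k. Y l \<omega> * of_bool (W (Suc a) \<omega> = l))"
      using AE_W_less[of "Suc a"]
      by (rule AE_mp) (auto simp: Z(1) of_bool_def if_distrib[of "\<lambda>x. _ * x"] cong: if_cong)
    show "(\<lambda>\<omega>. \<Sum>l<k. Y l \<omega> * of_bool (W (Suc a) \<omega> = l)) \<in> borel_measurable M"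
      using int_mult by (intro borel_measurable_sum) auto
  qed (rule determined_borel[OF Z(2)])
  also have "\<dots> = (\<Sum>l<k. expectation (\<lambda>\<omega>. Y l \<omega> * of_bool (W (Suc a) \<omega> = l)))"
    using int_mult by (intro Bochner_Integration.integral_sum) auto
  also have "\<dots> = (\<Sum>l<k. expectation (Y l) * w (Suc a) l)"
  proof (rule sum.cong)
    fix l assume l: "l \<in> {..<k}"
    have "expectation (\<lambda>\<omega>. of_bool (W (Suc a) \<omega> = l)) = expectation (indicator {\<omega> \<in> space M. W (Suc a) \<omega> = l})"
      by (intro Bochner_Integration.integral_cong) (auto simp: indicator_def)
    also have "\<dots> = w (Suc a) l" using W_prob[of "Suc a" l] l by (simp add: w_def)
    finally show "expectation (\<lambda>\<omega>. Y l \<omega> * of_bool (W (Suc a) \<omega> = l)) = expectation (Y l) * w (Suc a) l"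
      using indep_var_lebesgue_integral[OF indep int ind, of l] l by simp
  qed simp
  also have "\<dots> = expectation (\<lambda>\<omega>. \<Sum>l<k. w (Suc a) l * Y l \<omega>)"
    using int by (subst Bochner_Integration.integral_sum) (auto simp: mult.commute)
  finally show ?thesis .
qed

lemma walk_pos_Suc: "walk_pos W (Suc m) \<omega> = walk_pos W m \<omega> + unit_vec (W (Suc m) \<omega>)"
proof
  fix j
  have "{i \<in> {1..Suc m}. W i \<omega> = j}
      = (if W (Suc m) \<omega> = j then insert (Suc m) {i \<in> {1..m}. W i \<omega> = j} else {i \<in> {1..m}. W i \<omega> = j})"
    by (auto simp: le_Suc_eq)
  then show "walk_pos W (Suc m) \<omega> j = (walk_pos W m \<omega> + unit_vec (W (Suc m) \<omega>)) j"
    by (auto simp: walk_pos_def plus_fun_apply unit_vec_def)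
qed

lemma weights_w_nonneg: "i \<ge> 1 \<Longrightarrow> weights k 0 (w i)"
  using alpha_pos alpha_sum tp[of i] by (auto simp: weights_def w_def intro: less_imp_le)

text \<open>The Markov property, tested against a bounded \<open>Y\<close> determined by the past.
  The last step is integrated out first, so \<open>\<phi>\<close> varies in the induction.\<close>

lemma expectation_steps:
  assumes Y: "determined a Y" "\<And>\<omega>. \<bar>Y \<omega>\<bar> \<le> 1" and \<phi>: "\<And>z. \<bar>\<phi> z\<bar> \<le> 1"
  shows "expectation (\<lambda>\<omega>. Y \<omega> * \<phi> (walk_pos W (a + n) \<omega>))
       = expectation (\<lambda>\<omega>. Y \<omega> * steps_op k (map w [Suc a..<Suc (a + n)]) \<phi> (walk_pos W a \<omega>))"
  using \<phi>
proof (induction n arbitrary: \<phi>)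
  case (Suc n)
  have weights: "\<forall>v\<in>set [w (Suc (a + n))]. weights k 0 v" using weights_w_nonneg by simp
  have Yn: "determined (a + n) Y" using determined_mono[OF Y(1)] by simp
  have "expectation (\<lambda>\<omega>. Y \<omega> * \<phi> (walk_pos W (a + Suc n) \<omega>))
      = expectation (\<lambda>\<omega>. \<Sum>l<k. w (Suc (a + n)) l * (Y \<omega> * \<phi> (walk_pos W (a + n) \<omega> + unit_vec l)))"
  proof (rule expectation_step[where B = 1])
    show "determined (a + n) (\<lambda>\<omega>. Y \<omega> * \<phi> (walk_pos W (a + n) \<omega> + unit_vec l))" for l
      by (intro determined_comp2[of _ _ _ "(*)"] Yn determined_comp[OF determined_walk_pos])
    show "\<bar>Y \<omega> * \<phi> (walk_pos W (a + n) \<omega> + unit_vec l)\<bar> \<le> 1" for l \<omega>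
      unfolding abs_mult by (intro mult_le_one Y(2) Suc.prems abs_ge_zero)
    show "determined (Suc (a + n)) (\<lambda>\<omega>. Y \<omega> * \<phi> (walk_pos W (a + Suc n) \<omega>))"
    proof (rule determined_comp2[of _ _ _ "(*)"])
      show "determined (Suc (a + n)) Y" by (rule determined_mono[OF Y(1)]) simp
      show "determined (Suc (a + n)) (\<lambda>\<omega>. \<phi> (walk_pos W (a + Suc n) \<omega>))"
        using determined_comp[OF determined_walk_pos[of "a + Suc n"], of \<phi>] by simp
    qed
  qed (simp add: walk_pos_Suc)
  also have "\<dots> = expectation (\<lambda>\<omega>. Y \<omega> * step_op k (w (Suc (a + n))) \<phi> (walk_pos W (a + n) \<omega>))"
    by (simp add: step_op_def sum_distrib_left mult.left_commute)
  also have "\<dots> = expectation (\<lambda>\<omega>. Y \<omega> *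
      steps_op k (map w [Suc a..<Suc (a + n)]) (step_op k (w (Suc (a + n))) \<phi>) (walk_pos W a \<omega>))"
    using steps_op_abs_le[OF weights, of \<phi> 1] Suc.prems by (intro Suc.IH) simp
  also have "steps_op k (map w [Suc a..<Suc (a + n)]) (step_op k (w (Suc (a + n))) \<phi>)
           = steps_op k (map w [Suc a..<Suc (a + Suc n)]) \<phi>"
    using steps_op_append[of k "map w [Suc a..<Suc (a + n)]" "[w (Suc (a + n))]" \<phi>] by simp
  finally show ?case .
qed simp

section \<open>Deviations from the conditional probability\<close>

definition pair :: "nat \<Rightarrow> 'a \<Rightarrow> real" where
  "pair i \<omega> = vis k (walk_pos W i \<omega>) * vis k (walk_pos W (Suc i) \<omega>)"

text \<open>The conditional expectation of \<open>pair i\<close> given the position \<open>z\<close>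
  at time \<open>i\<close>.\<close>

definition next_pair :: "nat \<Rightarrow> (nat \<Rightarrow> int) \<Rightarrow> real" where
  "next_pair i z = (\<Sum>l<k. w (Suc i) l * (vis k z * vis k (z + unit_vec l)))"

text \<open>The conditional expectation of \<^term>\<open>pair i\<close> given the first \<open>i - L\<close> steps; for \<open>i < L\<close> truncated subtraction makes it the expectation.\<close>

definition predicted_pair :: "nat \<Rightarrow> nat \<Rightarrow> 'a \<Rightarrow> real" where
  "predicted_pair L i \<omega> = steps_op k (map w [Suc (i - L)..<Suc i]) (next_pair i) (walk_pos W (i - L) \<omega>)"

lemma vis_bounds: "0 \<le> vis k z" "vis k z \<le> 1"
  by (simp_all add: vis_def)

lemma vis_mult_bounds: "0 \<le> vis k z * vis k y" "vis k z * vis k y \<le> 1"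
  by (simp_all add: vis_def)

lemma pair_bounds: "0 \<le> pair i \<omega>" "pair i \<omega> \<le> 1"
  by (simp_all add: pair_def vis_mult_bounds)

lemma next_pair_bounds: "0 \<le> next_pair i z" "next_pair i z \<le> 1"
proof -
  have *: "weights k 0 (w (Suc i))" by (rule weights_w_nonneg) simp
  then have "(\<Sum>l<k. w (Suc i) l * (vis k z * vis k (z + unit_vec l))) \<le> (\<Sum>l<k. w (Suc i) l * 1)"
    unfolding weights_def using vis_mult_bounds by (intro sum_mono mult_left_mono) auto
  then show "next_pair i z \<le> 1" using * by (simp add: next_pair_def weights_def)
  show "0 \<le> next_pair i z"
    using * vis_mult_bounds by (auto simp: next_pair_def weights_def intro!: sum_nonneg)
qed

lemma predicted_pair_bounds: "0 \<le> predicted_pair L i \<omega>" "predicted_pair L i \<omega> \<le> 1"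
proof -
  have w: "\<forall>v\<in>set (map w [Suc (i - L)..<Suc i]). weights k 0 v" using weights_w_nonneg by auto
  have "steps_op k (map w [Suc (i - L)..<Suc i]) (\<lambda>_. 0) (walk_pos W (i - L) \<omega>) \<le> predicted_pair L i \<omega>"
    unfolding predicted_pair_def by (intro steps_op_mono[OF w] next_pair_bounds) auto
  moreover have "predicted_pair L i \<omega> \<le> steps_op k (map w [Suc (i - L)..<Suc i]) (\<lambda>_. 1) (walk_pos W (i - L) \<omega>)"
    unfolding predicted_pair_def by (intro steps_op_mono[OF w] next_pair_bounds) auto
  ultimately show "0 \<le> predicted_pair L i \<omega>" "predicted_pair L i \<omega> \<le> 1"
    by (simp_all only: steps_op_const[OF w])
qed

lemma determined_pair: "determined (Suc i) (pair i)"
  unfolding pair_def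
  by (intro determined_comp2[of _ _ _ "\<lambda>x y. vis k x * vis k y"] determined_walk_pos
        determined_mono[OF determined_walk_pos[of i]]) simp

lemma determined_predicted_pair: "determined (i - L) (predicted_pair L i)"
  unfolding predicted_pair_def by (rule determined_comp[OF determined_walk_pos])

definition deviation :: "nat \<Rightarrow> nat \<Rightarrow> 'a \<Rightarrow> real" where
  "deviation L i \<omega> = pair i \<omega> - predicted_pair L i \<omega>"

lemma determined_deviation: "determined (Suc i) (deviation L i)"
  unfolding deviation_def
  by (intro determined_comp2[of _ _ _ "(-)"] determined_pair determined_mono[OF determined_predicted_pair]) simp

lemma abs_deviation_le: "\<bar>deviation L i \<omega>\<bar> \<le> 1"
  using pair_bounds[of i \<omega>] predicted_pair_bounds[of L i \<omega>] by (simp add: deviation_def)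

text \<open>Integrating out step \<open>i + 1\<close> turns \<open>pair i\<close> into
  \<open>next_pair i\<close>, and integrating out the steps after \<open>i - L\<close> turns this
  into the prediction; so deviations are orthogonal to the past.\<close>

lemma expectation_deviation:
  assumes Y: "determined (i - L) Y" "\<And>\<omega>. \<bar>Y \<omega>\<bar> \<le> 1"
  shows "expectation (\<lambda>\<omega>. Y \<omega> * deviation L i \<omega>) = 0"
proof -
  have Yi: "determined i Y" using determined_mono[OF Y(1)] by simp
  have int1: "integrable M (\<lambda>\<omega>. Y \<omega> * pair i \<omega>)"
    using Y pair_bounds determined_mono[OF Yi, of "Suc i"]
    by (intro determined_integrable[where a = "Suc i" and B = 1] determined_comp2[of _ _ _ "(*)"] determined_pair)
       (auto simp: abs_mult intro!: mult_le_one)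
  have int2: "integrable M (\<lambda>\<omega>. Y \<omega> * predicted_pair L i \<omega>)"
    using Y predicted_pair_bounds
    by (intro determined_integrable[where a = "i - L" and B = 1] determined_comp2[of _ _ _ "(*)"]
          determined_predicted_pair)
       (auto simp: abs_mult intro!: mult_le_one)
  have "expectation (\<lambda>\<omega>. Y \<omega> * pair i \<omega>)
      = expectation (\<lambda>\<omega>. \<Sum>l<k. w (Suc i) l *
          (Y \<omega> * (vis k (walk_pos W i \<omega>) * vis k (walk_pos W i \<omega> + unit_vec l))))"
  proof (rule expectation_step[where B = 1])
    show "determined i (\<lambda>\<omega>. Y \<omega> * (vis k (walk_pos W i \<omega>) * vis k (walk_pos W i \<omega> + unit_vec l)))" for l
      by (intro determined_comp2[of _ Y _ "\<lambda>y x. y * (vis k x * vis k (x + unit_vec l))"] Yi determined_walk_pos)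
    show "\<bar>Y \<omega> * (vis k (walk_pos W i \<omega>) * vis k (walk_pos W i \<omega> + unit_vec l))\<bar> \<le> 1" for l \<omega>
      using Y(2) vis_bounds by (auto simp: abs_mult intro!: mult_le_one)
    show "determined (Suc i) (\<lambda>\<omega>. Y \<omega> * pair i \<omega>)"
      by (intro determined_comp2[of _ _ _ "(*)"] determined_pair determined_mono[OF Yi]) simp
  qed (simp add: pair_def walk_pos_Suc)
  also have "\<dots> = expectation (\<lambda>\<omega>. Y \<omega> * next_pair i (walk_pos W i \<omega>))"
    by (simp add: next_pair_def sum_distrib_left mult.left_commute)
  also have "\<dots> = expectation (\<lambda>\<omega>. Y \<omega> * predicted_pair L i \<omega>)"
    \<comment> \<open>The number of steps \<open>i - (i - L)\<close> is the minimum of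
      \<open>i\<close> and \<open>L\<close>, which covers times before \<open>L\<close> as
      well.\<close>
    using expectation_steps[OF Y, of "next_pair i" "i - (i - L)"] next_pair_bounds
    by (simp add: predicted_pair_def)
  finally show ?thesis
    using int1 int2 by (simp add: deviation_def right_diff_distrib)
qed

lemma expectation_deviation_mult:
  "\<bar>expectation (\<lambda>\<omega>. deviation L i \<omega> * deviation L j \<omega>)\<bar> \<le> of_bool (i \<le> j + L \<and> j \<le> i + L)"
proof -
  \<comment> \<open>\<open>deviation L i\<close> depends on \<open>i + 1\<close> steps, and
    \<open>j > i + L\<close> gives \<open>i + 1 \<le> j - L\<close>.\<close>
  have *: "expectation (\<lambda>\<omega>. deviation L i \<omega> * deviation L j \<omega>) = 0" if "j > i + L" for i j
    using that by (intro expectation_deviation abs_deviation_le determined_mono[OF determined_deviation]) simp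
  consider "j > i + L" | "i > j + L" | "i \<le> j + L" "j \<le> i + L" by linarith
  then show ?thesis
  proof cases
    case 3
    have "\<bar>expectation (\<lambda>\<omega>. deviation L i \<omega> * deviation L j \<omega>)\<bar>
            \<le> expectation (\<lambda>\<omega>. \<bar>deviation L i \<omega> * deviation L j \<omega>\<bar>)"
      by (rule integral_abs_bound)
    also have "\<dots> \<le> expectation (\<lambda>_. 1)"
    proof (intro integral_mono integrable_abs)
      show "integrable M (\<lambda>\<omega>. deviation L i \<omega> * deviation L j \<omega>)"
        using determined_mono[OF determined_deviation[of i L], of "max (Suc i) (Suc j)"]
          determined_mono[OF determined_deviation[of j L], of "max (Suc i) (Suc j)"]
        by (intro determined_integrable[where B=1] determined_comp2[of _ _ _ "(*)"])
           (auto simp: abs_mult intro!: mult_le_one abs_deviation_le)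
    qed (auto simp: abs_mult intro!: mult_le_one abs_deviation_le)
    finally show ?thesis using 3 by (simp add: prob_space)
  qed (use *[of i j] *[of j i] in \<open>simp_all add: mult.commute\<close>)
qed

text \<open>Only pairs of times within distance \<open>L\<close> contribute, at most
  \<open>2 * L + 1\<close> for each time.\<close>

lemma expectation_sum_deviation_square:
  "expectation (\<lambda>\<omega>. (\<Sum>i=1..n. deviation L i \<omega>)\<^sup>2) \<le> n * (2 * L + 1)"
proof -
  have int: "integrable M (\<lambda>\<omega>. deviation L i \<omega> * deviation L j \<omega>)" for i j
    using determined_mono[OF determined_deviation[of i L], of "max (Suc i) (Suc j)"]
      determined_mono[OF determined_deviation[of j L], of "max (Suc i) (Suc j)"]
    by (intro determined_integrable[where B=1] determined_comp2[of _ _ _ "(*)"])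
       (auto simp: abs_mult intro!: mult_le_one abs_deviation_le)
  have "expectation (\<lambda>\<omega>. (\<Sum>i=1..n. deviation L i \<omega>)\<^sup>2)
      = (\<Sum>i=1..n. \<Sum>j=1..n. expectation (\<lambda>\<omega>. deviation L i \<omega> * deviation L j \<omega>))"
    by (simp add: power2_eq_square sum_product int)
  also have "\<dots> \<le> (\<Sum>i=1..n. \<Sum>j=1..n. of_bool (i \<le> j + L \<and> j \<le> i + L))"
    using expectation_deviation_mult by (intro sum_mono) (meson abs_le_D1)
  also have "\<dots> \<le> (\<Sum>i=1..n. real (2 * L + 1))"
  proof (rule sum_mono)
    fix i assume "i \<in> {1..n}"
    have "(\<Sum>j=1..n. of_bool (i \<le> j + L \<and> j \<le> i + L)) = real (card {j \<in> {1..n}. i \<le> j + L \<and> j \<le> i + L})"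
      by (simp add: Int_def)
    also have "\<dots> \<le> card {i - L..i + L}" by (intro of_nat_mono card_mono) auto
    also have "\<dots> \<le> real (2 * L + 1)" by (simp only: card_atLeastAtMost of_nat_le_iff)
    finally show "(\<Sum>j=1..n. of_bool (i \<le> j + L \<and> j \<le> i + L)) \<le> real (2 * L + 1)" .
  qed
  finally show ?thesis by (simp add: algebra_simps)
qed

end

section \<open>From expectations, subsequences and approximations to limits\<close>

lemma AE_tendsto_0_of_summable_expectation:
  fixes f :: "nat \<Rightarrow> 'a \<Rightarrow> real"
  assumes int: "\<And>m. integrable M (f m)" and nonneg: "\<And>m \<omega>. 0 \<le> f m \<omega>"
    and le: "\<And>m. integral\<^sup>L M (f m) \<le> b m" and b: "summable b"
  shows "AE \<omega> in M. (\<lambda>m. f m \<omega>) \<longlonglongrightarrow> 0"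
proof -
  have [measurable]: "f m \<in> borel_measurable M" for m using int by auto
  have b0: "0 \<le> b m" for m using le[of m] nonneg Bochner_Integration.integral_nonneg[of M "f m"] by (meson order_trans)
  \<comment> \<open>Summable expectations make the sum of the \<open>f m\<close> finite almost
    surely, so its terms tend to 0.\<close>
  have "(\<integral>\<^sup>+\<omega>. (\<Sum>m. ennreal (f m \<omega>)) \<partial>M) = (\<Sum>m. \<integral>\<^sup>+\<omega>. ennreal (f m \<omega>) \<partial>M)"
    by (intro nn_integral_suminf) auto
  also have "\<dots> \<le> (\<Sum>m. ennreal (b m))"
  proof (intro suminf_le)
    show "(\<integral>\<^sup>+\<omega>. ennreal (f m \<omega>) \<partial>M) \<le> ennreal (b m)" for m
      using int nonneg le by (subst nn_integral_eq_integral) (auto intro: ennreal_leI)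
  qed auto
  also have "\<dots> = ennreal (suminf b)" using b b0 by (intro suminf_ennreal2)
  finally have "(\<integral>\<^sup>+\<omega>. (\<Sum>m. ennreal (f m \<omega>)) \<partial>M) \<noteq> \<infinity>"
    by (auto simp: top_unique)
  then have "AE \<omega> in M. (\<Sum>m. ennreal (f m \<omega>)) \<noteq> \<infinity>"
    by (intro nn_integral_PInf_AE) auto
  then show ?thesis
  proof (rule AE_mp, intro AE_I2 impI)
    fix \<omega> assume "(\<Sum>m. ennreal (f m \<omega>)) \<noteq> \<infinity>"
    then have "summable (\<lambda>m. f m \<omega>)"
      using nonneg by (intro summable_suminf_not_top) auto
    then show "(\<lambda>m. f m \<omega>) \<longlonglongrightarrow> 0" by (rule summable_LIMSEQ_zero)
  qed
qed

text \<open>Nonnegative terms make the partial sums monotone, so the mean at \<open>n\<close> lies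
  between those at neighbouring fourth powers up to the ratio of these powers, which tends to
  1.\<close>

lemma mean_tendsto_of_fourth_powers:
  fixes x :: "nat \<Rightarrow> real"
  assumes x: "\<And>i. 0 \<le> x i"
    and lim: "(\<lambda>m. (\<Sum>i=1..m ^ 4. x i) / real (m ^ 4)) \<longlonglongrightarrow> l"
  shows "(\<lambda>n. (\<Sum>i=1..n. x i) / real n) \<longlonglongrightarrow> l"
proof -
  define r where "r n = nat \<lfloor>root 4 (real n)\<rfloor>" for n
  define A where "A m = (\<Sum>i=1..m ^ 4. x i) / real (m ^ 4)" for m
  have r: "filterlim r at_top at_top" unfolding r_def by real_asymp
  have bounds: "r n ^ 4 \<le> n" "n \<le> Suc (r n) ^ 4" for n
  proof -
    have "0 \<le> root 4 (real n)" by simp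
    then have "real (r n) = of_int \<lfloor>root 4 (real n)\<rfloor>" by (simp add: r_def)
    then have *: "real (r n) \<le> root 4 (real n)" "root 4 (real n) \<le> real (Suc (r n))" by linarith+
    have "real (r n) ^ 4 \<le> root 4 (real n) ^ 4" by (intro power_mono *) auto
    then show "r n ^ 4 \<le> n" by (simp flip: of_nat_power)
    have "root 4 (real n) ^ 4 \<le> real (Suc (r n)) ^ 4" by (intro power_mono *) auto
    then show "n \<le> Suc (r n) ^ 4" by (simp flip: of_nat_power del: of_nat_Suc)
  qed
  have mono: "(\<Sum>i=1..a. x i) \<le> (\<Sum>i=1..b. x i)" if "a \<le> b" for a b
    using that x by (intro sum_mono2) auto
  have rpos: "eventually (\<lambda>n. 1 \<le> r n) at_top"
    using r by (auto simp: filterlim_at_top)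
  have "(\<lambda>m. A m * (real (m ^ 4) / real (Suc m ^ 4))) \<longlonglongrightarrow> l * 1"
  proof (rule tendsto_mult)
    show "A \<longlonglongrightarrow> l" using lim unfolding A_def[symmetric] .
    show "(\<lambda>m. real (m ^ 4) / real (Suc m ^ 4)) \<longlonglongrightarrow> 1" unfolding of_nat_power by real_asymp
  qed
  then have lower: "(\<lambda>n. A (r n) * (real (r n ^ 4) / real (Suc (r n) ^ 4))) \<longlonglongrightarrow> l"
    using filterlim_compose[OF _ r] by fastforce
  have "(\<lambda>m. A (Suc m) * (real (Suc m ^ 4) / real (m ^ 4))) \<longlonglongrightarrow> l * 1"
  proof (rule tendsto_mult)
    show "(\<lambda>m. A (Suc m)) \<longlonglongrightarrow> l" using LIMSEQ_Suc[OF lim[folded A_def]] .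
    show "(\<lambda>m. real (Suc m ^ 4) / real (m ^ 4)) \<longlonglongrightarrow> 1" unfolding of_nat_power by real_asymp
  qed
  then have upper: "(\<lambda>n. A (Suc (r n)) * (real (Suc (r n) ^ 4) / real (r n ^ 4))) \<longlonglongrightarrow> l"
    using filterlim_compose[OF _ r] by fastforce
  show ?thesis
  proof (rule tendsto_sandwich[OF _ _ lower upper])
    show "eventually (\<lambda>n. A (r n) * (real (r n ^ 4) / real (Suc (r n) ^ 4)) \<le> (\<Sum>i=1..n. x i) / real n) at_top"
      using rpos
    proof eventually_elim
      case (elim n)
      have n: "n > 0" using bounds(1)[of n] elim by (metis gr0I le_zero_eq not_one_le_zero power_eq_0_iff)
      have "A (r n) * (real (r n ^ 4) / real (Suc (r n) ^ 4)) = (\<Sum>i=1..r n ^ 4. x i) / real (Suc (r n) ^ 4)"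
        using elim by (simp add: A_def)
      also have "\<dots> \<le> (\<Sum>i=1..n. x i) / real n"
        using mono[OF bounds(1)] bounds(2)[of n] n x by (intro frac_le sum_nonneg) (auto simp del: of_nat_power)
      finally show ?case .
    qed
    show "eventually (\<lambda>n. (\<Sum>i=1..n. x i) / real n \<le> A (Suc (r n)) * (real (Suc (r n) ^ 4) / real (r n ^ 4))) at_top"
      using rpos
    proof eventually_elim
      case (elim n)
      have "(\<Sum>i=1..n. x i) / real n \<le> (\<Sum>i=1..Suc (r n) ^ 4. x i) / real (r n ^ 4)"
        using mono[OF bounds(2)] bounds(1)[of n] elim x by (intro frac_le sum_nonneg) (auto simp del: of_nat_power)
      also have "\<dots> = A (Suc (r n)) * (real (Suc (r n) ^ 4) / real (r n ^ 4))"
        by (simp add: A_def del: of_nat_Suc)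
      finally show ?case .
    qed
  qed
qed

lemma sieve_mean_bounds:
  assumes "\<forall>p\<in>Q. prime p"
  shows "0 \<le> sieve_mean k Q i" "sieve_mean k Q i \<le> 1"
proof -
  have "0 \<le> 1 - of_bool (p dvd i \<or> p dvd Suc i) / real p ^ (k - 1) \<and>
        1 - of_bool (p dvd i \<or> p dvd Suc i) / real p ^ (k - 1) \<le> 1" if "p \<in> Q" for p
  proof -
    have "1 \<le> real p ^ (k - 1)"
      using assms that prime_gt_0_nat by (intro one_le_power) (auto simp: Suc_le_eq)
    then have "0 \<le> 1 / real p ^ (k - 1)" "1 / real p ^ (k - 1) \<le> 1"
      by (simp_all only: divide_le_eq_1) auto
    then show ?thesis by (simp add: of_bool_def)
  qed
  then show "0 \<le> sieve_mean k Q i" "sieve_mean k Q i \<le> 1"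
    unfolding sieve_mean_def by (auto intro!: prod_nonneg prod_le_1)
qed

text \<open>The two tails contribute \<open>1 / P\<close> each; the logarithm loses against
  \<open>sqrt (D / m)\<close>.\<close>

lemma error_tendsto:
  fixes C D P :: real
  assumes "D > 0"
  shows "(\<lambda>m::nat. 1 / real m ^ 2 + C * (D / m)
            + 2 * ((real m ^ 4 + 1) / real m ^ 4) * (1 / P + 3 * sqrt (D / m) * (1 + ln (real m ^ 4 + 1))))
          \<longlonglongrightarrow> 2 / P"
proof -
  have "(\<lambda>m::nat. 1 / real m ^ 2 + C * (D / m)
            + 2 * ((real m ^ 4 + 1) / real m ^ 4) * (1 / P + 3 * sqrt (D / m) * (1 + ln (real m ^ 4 + 1))))
          \<longlonglongrightarrow> 0 + C * 0 + 2 * 1 * (1 / P + 0)"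
  proof (intro tendsto_add tendsto_mult tendsto_const)
    show "(\<lambda>m::nat. 3 * sqrt (D / m) * (1 + ln (real m ^ 4 + 1))) \<longlonglongrightarrow> 0"
      using assms by real_asymp
  qed real_asymp+
  then show ?thesis by simp
qed

text \<open>\<open>P\<close> is fixed first, making \<open>2 / P\<close> and the distance of
  \<open>L P\<close> from the limit small; only then is \<open>m\<close> taken large.\<close>

lemma tendsto_of_approximations:
  fixes a :: "nat \<Rightarrow> real"
  assumes "\<And>P. P \<ge> 1 \<Longrightarrow> s P \<longlonglongrightarrow> L P" "\<And>P. P \<ge> 1 \<Longrightarrow> e P \<longlonglongrightarrow> 2 / real P"
    and "\<And>P m. P \<ge> 1 \<Longrightarrow> m \<ge> 1 \<Longrightarrow> \<bar>a m - s P m\<bar> \<le> e P m" and L: "L \<longlonglongrightarrow> l"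
  shows "a \<longlonglongrightarrow> l"
proof (rule LIMSEQ_I)
  fix \<epsilon> :: real assume \<epsilon>: "\<epsilon> > 0"
  have "(\<lambda>P. 2 / real P) \<longlonglongrightarrow> 0" by (rule lim_const_over_n)
  then have "eventually (\<lambda>P. 2 / real P < \<epsilon> / 4) sequentially"
    using \<epsilon> by (intro order_tendstoD(2)[of _ 0]) auto
  moreover have "eventually (\<lambda>P. dist (L P) l < \<epsilon> / 4) sequentially"
    using L \<epsilon> by (intro tendstoD) auto
  ultimately have "eventually (\<lambda>P. 2 / real P < \<epsilon> / 4 \<and> dist (L P) l < \<epsilon> / 4 \<and> P \<ge> 1) sequentially"
    using eventually_ge_at_top[of "1::nat"] by eventually_elim auto
  then obtain P where P: "2 / real P < \<epsilon> / 4" "dist (L P) l < \<epsilon> / 4" "P \<ge> 1"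
    using eventually_happens'[OF sequentially_bot] by blast
  have "eventually (\<lambda>m. dist (s P m) (L P) < \<epsilon> / 4) sequentially"
    using assms(1)[OF P(3)] \<epsilon> by (intro tendstoD) auto
  moreover have "eventually (\<lambda>m. dist (e P m) (2 / real P) < \<epsilon> / 4) sequentially"
    using assms(2)[OF P(3)] \<epsilon> by (intro tendstoD) auto
  ultimately have "eventually (\<lambda>m. norm (a m - l) < \<epsilon>) sequentially"
    using eventually_ge_at_top[of "1::nat"]
  proof eventually_elim
    case (elim m)
    have "\<bar>a m - s P m\<bar> \<le> e P m" using assms(3) P(3) elim(3) by blast
    then show ?case using elim P unfolding dist_real_def real_norm_def by linarith
  qed
  then show "\<exists>m0. \<forall>m\<ge>m0. norm (a m - l) < \<epsilon>" by (simp add: eventually_sequentially)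
qed

section \<open>Almost sure convergence of the means\<close>

context type_walk
begin

text \<open>The second moment of the mean is at most
  \<open>(2 * m\<^sup>2 + 1) / m ^ 4 \<le> 3 / m\<^sup>2\<close>, so the squared means tend to 0
  almost surely.\<close>

lemma AE_mean_deviation:
  "AE \<omega> in M. (\<lambda>m. (\<Sum>i=1..m ^ 4. deviation (m\<^sup>2) i \<omega>) / real (m ^ 4)) \<longlonglongrightarrow> 0"
proof -
  define D where "D m \<omega> = (\<Sum>i=1..m ^ 4. deviation (m\<^sup>2) i \<omega>)" for m \<omega>
  have D: "determined (Suc (m ^ 4)) (D m)" for m
    unfolding determined_def D_def
  proof (intro allI impI sum.cong)
    fix \<omega> \<omega>' i assume "\<forall>i\<in>{1..Suc (m ^ 4)}. W i \<omega> = W i \<omega>'" "i \<in> {1..m ^ 4}"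
    then show "deviation (m\<^sup>2) i \<omega> = deviation (m\<^sup>2) i \<omega>'"
      using determined_deviation[of i "m\<^sup>2"] unfolding determined_def by auto
  qed simp
  have "AE \<omega> in M. (\<lambda>m. (D m \<omega> / real (m ^ 4))\<^sup>2) \<longlonglongrightarrow> 0"
  proof (rule AE_tendsto_0_of_summable_expectation)
    show "summable (\<lambda>m. 3 * inverse (real m ^ 2))" by (intro summable_mult inverse_power_summable) simp
    fix m :: nat
    have Dm: "\<bar>D m \<omega>\<bar> \<le> m ^ 4" for \<omega>
    proof -
      have "\<bar>D m \<omega>\<bar> \<le> (\<Sum>i=1..m ^ 4. 1)"
        unfolding D_def by (intro order_trans[OF sum_abs] sum_mono abs_deviation_le)
      then show ?thesis by simp
    qed
    have "(D m \<omega>)\<^sup>2 \<le> (real (m ^ 4))\<^sup>2" for \<omega>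
      using power_mono[OF Dm[of \<omega>], of 2] by simp
    then have "integrable M (\<lambda>\<omega>. (D m \<omega>)\<^sup>2)"
      by (intro determined_integrable[where a = "Suc (m ^ 4)" and B = "(real (m ^ 4))\<^sup>2"] determined_comp[OF D, where f = "\<lambda>x. x\<^sup>2"]) auto
    then show "integrable M (\<lambda>\<omega>. (D m \<omega> / real (m ^ 4))\<^sup>2)"
      unfolding power_divide by simp
    show "expectation (\<lambda>\<omega>. (D m \<omega> / real (m ^ 4))\<^sup>2) \<le> 3 * inverse (real m ^ 2)"
    proof (cases "m = 0")
      case False
      have "expectation (\<lambda>\<omega>. (D m \<omega> / real (m ^ 4))\<^sup>2) = expectation (\<lambda>\<omega>. (D m \<omega>)\<^sup>2) / (real (m ^ 4))\<^sup>2"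
        unfolding power_divide by simp
      also have "\<dots> \<le> (m ^ 4 * (2 * m\<^sup>2 + 1)) / (real (m ^ 4))\<^sup>2"
        unfolding D_def by (intro divide_right_mono expectation_sum_deviation_square) auto
      also have "\<dots> \<le> (m ^ 4 * (3 * m\<^sup>2)) / (real (m ^ 4))\<^sup>2"
      proof (intro divide_right_mono)
        have "m ^ 4 * (2 * m\<^sup>2 + 1) \<le> m ^ 4 * (3 * m\<^sup>2)" using False by (intro mult_left_mono) auto
        then show "real (m ^ 4 * (2 * m\<^sup>2 + 1)) \<le> real (m ^ 4 * (3 * m\<^sup>2))" by (simp only: of_nat_le_iff)
      qed auto
      also have "\<dots> = 3 * inverse (real m ^ 2)"
        using False by (simp add: field_simps eval_nat_numeral)
      finally show ?thesis .
    qed (simp add: D_def)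
  qed auto
  then show ?thesis
  proof (rule AE_mp, intro AE_I2 impI)
    fix \<omega> assume "(\<lambda>m. (D m \<omega> / real (m ^ 4))\<^sup>2) \<longlonglongrightarrow> 0"
    then have "(\<lambda>m. sqrt ((D m \<omega> / real (m ^ 4))\<^sup>2)) \<longlonglongrightarrow> sqrt 0" by (rule tendsto_real_sqrt)
    then have "(\<lambda>m. \<bar>D m \<omega> / real (m ^ 4)\<bar>) \<longlonglongrightarrow> 0" by (simp only: real_sqrt_abs real_sqrt_zero)
    then show "(\<lambda>m. (\<Sum>i=1..m ^ 4. deviation (m\<^sup>2) i \<omega>) / real (m ^ 4)) \<longlonglongrightarrow> 0"
      unfolding D_def by (simp only: tendsto_rabs_zero_iff)
  qed
qed

lemma sum_walk_pos:
  assumes "\<forall>i\<ge>1. W i \<omega> < k"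
  shows "(\<Sum>j<k. walk_pos W i \<omega> j) = int i"
proof (induction i)
  case 0
  show ?case by (simp add: walk_pos_def)
next
  case (Suc i)
  have "W (Suc i) \<omega> < k" using assms by simp
  then show ?case using Suc by (simp add: walk_pos_Suc sum_add_unit_vec)
qed

lemma uniform_weights: "\<exists>c>0. \<forall>t<q. weights k c (alpha t)"
proof -
  define S where "S = (\<lambda>(t, j). alpha t j) ` ({..<q} \<times> {..<k})"
  have "tp 1 < q" using tp by simp
  then have "(tp 1, 0) \<in> {..<q} \<times> {..<k}" using k by simp
  then have S: "finite S" "S \<noteq> {}" by (auto simp: S_def)
  have "Min S > 0" using S alpha_pos by (auto simp: S_def)
  moreover have "weights k (Min S) (alpha t)" if "t < q" for t
    using that alpha_sum S(1) by (force simp: weights_def S_def intro!: Min_le)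
  ultimately show ?thesis by blast
qed

text \<open>The \<open>L\<close> steps up to time \<open>i\<close> have flatness
  \<open>sqrt (2 * q / (c * L))\<close> whatever their sequence of types. The prediction averages
  the pair estimate over the direction of step \<open>i + 1\<close>.\<close>

lemma predicted_pair_error:
  assumes \<omega>: "\<forall>i\<ge>1. W i \<omega> < k" and c: "c > 0" "\<forall>t<q. weights k c (alpha t)"
    and C: "pair_error k P C" and L: "0 < L" "L < i"
  defines "\<eta> \<equiv> sqrt (2 * q / (c * L))"
  shows "\<bar>predicted_pair L i \<omega> - sieve_mean k {p. prime p \<and> p \<le> P} i\<bar>
           \<le> C * \<eta> + tail P (3 * sqrt \<eta>) i + tail P (3 * sqrt \<eta>) (Suc i)"
proof -
  define ts where "ts = map tp [Suc (i - L)..<Suc i]"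
  have ws: "map w [Suc (i - L)..<Suc i] = map alpha ts" by (simp add: ts_def w_def)
  have len: "length ts = L" using L by (simp add: ts_def)
  have ts: "\<forall>t\<in>set ts. t < q" using tp by (auto simp: ts_def)
  have "tp 1 < q" using tp by simp
  then have \<eta>: "\<eta> > 0" using c L by (simp add: \<eta>_def)
  have flat: "flat k \<eta> (map alpha ts)"
    using flat_steps[OF c(2,1) ts] len L by (auto simp: \<eta>_def)
  have weights: "\<forall>v\<in>set (map alpha ts). weights k c v" using c(2) ts by auto
  define x where "x = walk_pos W (i - L) \<omega>"
  have x: "(\<Sum>j<k. x j) + int (length (map alpha ts)) = int i"
    using sum_walk_pos[OF \<omega>] L by (simp add: x_def len)
  define h where "h l = steps_op k (map alpha ts) (\<lambda>z. vis k z * vis k (z + unit_vec l)) x" for l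
  define s where "s = sieve_mean k {p. prime p \<and> p \<le> P} i"
  define B where "B = C * \<eta> + tail P (3 * sqrt \<eta>) i + tail P (3 * sqrt \<eta>) (Suc i)"
  have h: "\<bar>h l - s\<bar> \<le> B" if "l < k" for l
    unfolding h_def s_def B_def
    by (rule C[unfolded pair_error_def, rule_format, OF flat bspec[OF weights] _ \<eta> that x]) (use c L in auto)
  have wi: "(\<Sum>l<k. w (Suc i) l) = 1" "\<And>l. l < k \<Longrightarrow> 0 \<le> w (Suc i) l"
    using weights_w_nonneg[of "Suc i"] by (auto simp: weights_def)
  have "predicted_pair L i \<omega> = (\<Sum>l<k. w (Suc i) l * h l)"
    unfolding predicted_pair_def next_pair_def[abs_def] steps_op_sum steps_op_cmult ws h_def x_def by simp
  then have "predicted_pair L i \<omega> - s = (\<Sum>l<k. w (Suc i) l * (h l - s))"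
    using wi(1) by (simp add: right_diff_distrib sum_subtractf flip: sum_distrib_right)
  also have "\<bar>\<dots>\<bar> \<le> (\<Sum>l<k. w (Suc i) l * B)"
    using h wi(2) by (intro order_trans[OF sum_abs] sum_mono) (auto simp: abs_mult intro!: mult_left_mono)
  also have "\<dots> = B" using wi(1) by (simp flip: sum_distrib_right)
  finally show ?thesis by (simp add: s_def B_def)
qed

lemma mean_predicted_pair:
  assumes \<omega>: "\<forall>i\<ge>1. W i \<omega> < k"
  shows "(\<lambda>m. (\<Sum>i=1..m ^ 4. predicted_pair (m\<^sup>2) i \<omega>) / real (m ^ 4))
           \<longlonglongrightarrow> (\<Prod>p. if prime p then 1 - 2 / real p ^ k else 1)"
proof -
  obtain c where c: "c > 0" "\<forall>t<q. weights k c (alpha t)" using uniform_weights by blast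
  have "\<exists>C. \<forall>P. 0 \<le> C P \<and> pair_error k P (C P)"
    using steps_op_visible_pair[OF k] by metis
  then obtain C where C: "\<And>P. 0 \<le> C P" "\<And>P. pair_error k P (C P)" by blast
  define D where "D = sqrt (2 * q / c)"
  have "tp 1 < q" using tp by simp
  then have D: "D > 0" using c by (simp add: D_def)
  let ?s = "\<lambda>P. sieve_mean k {p. prime p \<and> p \<le> P}"
  define e where "e P m = 1 / real m ^ 2 + C P * (D / real m)
     + 2 * ((real m ^ 4 + 1) / real m ^ 4) * (1 / real P + 3 * sqrt (D / real m) * (1 + ln (real m ^ 4 + 1)))" for P m
  show ?thesis
  proof (rule tendsto_of_approximations)
    fix P :: nat assume P: "P \<ge> 1"
    have "(\<lambda>n. (\<Sum>i=1..n. ?s P i) / n) \<longlonglongrightarrow> (\<Prod>p\<in>{p. prime p \<and> p \<le> P}. 1 - 2 / real p ^ k)"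
      using k by (intro mean_sieve_mean) auto
    moreover have "filterlim (\<lambda>m::nat. m ^ 4) at_top at_top" by real_asymp
    ultimately show "(\<lambda>m. (\<Sum>i=1..m ^ 4. ?s P i) / real (m ^ 4)) \<longlonglongrightarrow> (\<Prod>p\<in>{p. prime p \<and> p \<le> P}. 1 - 2 / real p ^ k)"
      by (rule filterlim_compose)
    show "e P \<longlonglongrightarrow> 2 / real P" unfolding e_def using error_tendsto[OF D] .
    fix m :: nat assume m: "m \<ge> 1"
    define n where "n = m ^ 4"
    define \<eta> where "\<eta> = D / m"
    have n: "real n = real m ^ 4" "n \<ge> 1" using m by (simp_all add: n_def)
    have \<eta>: "\<eta> \<ge> 0" using D by (simp add: \<eta>_def)
    \<comment> \<open>The choice \<open>L = m\<^sup>2\<close> makes \<open>\<eta>\<close> decay like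
      \<open>1 / m\<close>.\<close>
    have \<eta>_eq: "sqrt (2 * q / (c * real (m\<^sup>2))) = \<eta>"
      using m by (simp add: \<eta>_def D_def real_sqrt_divide real_sqrt_mult)
    define \<kappa> where "\<kappa> = 3 * sqrt \<eta>"
    have tail: "0 \<le> tail P \<kappa> i" for i
      unfolding tail_def \<kappa>_def using \<eta> by (intro sum_nonneg) auto
    \<comment> \<open>Times up to \<open>m\<^sup>2\<close> have too short a past for the smoothing
      estimate and get the trivial bound 1; they are at most \<open>m\<^sup>2\<close> of the
      \<open>m ^ 4\<close> times.\<close>
    have diff: "\<bar>predicted_pair (m\<^sup>2) i \<omega> - ?s P i\<bar>
        \<le> of_bool (i \<le> m\<^sup>2) + C P * \<eta> + (tail P \<kappa> i + tail P \<kappa> (Suc i))" for i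
    proof (cases "i \<le> m\<^sup>2")
      case True
      have "\<bar>predicted_pair (m\<^sup>2) i \<omega> - ?s P i\<bar> \<le> 1"
        using predicted_pair_bounds[of "m\<^sup>2" i \<omega>] sieve_mean_bounds[of "{p. prime p \<and> p \<le> P}" k i] by auto
      moreover have "0 \<le> C P * \<eta>" using C(1) \<eta> by simp
      ultimately show ?thesis using True tail[of i] tail[of "Suc i"] by simp
    next
      case False
      have "\<bar>predicted_pair (m\<^sup>2) i \<omega> - ?s P i\<bar> \<le> C P * \<eta> + tail P \<kappa> i + tail P \<kappa> (Suc i)"
        using predicted_pair_error[OF \<omega> c C(2), of "m\<^sup>2" i P, unfolded \<eta>_eq] False m by (simp add: \<kappa>_def)
      then show ?thesis using False by simp
    qed
    have "\<bar>(\<Sum>i=1..n. predicted_pair (m\<^sup>2) i \<omega>) - (\<Sum>i=1..n. ?s P i)\<bar>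
        = \<bar>\<Sum>i=1..n. predicted_pair (m\<^sup>2) i \<omega> - ?s P i\<bar>" by (simp only: sum_subtractf)
    also have "\<dots> \<le> (\<Sum>i=1..n. of_bool (i \<le> m\<^sup>2) + C P * \<eta> + (tail P \<kappa> i + tail P \<kappa> (Suc i)))"
      by (rule order_trans[OF sum_abs]) (rule sum_mono, rule diff)
    also have "\<dots> = (\<Sum>i=1..n. of_bool (i \<le> m\<^sup>2)) + n * (C P * \<eta>)
        + ((\<Sum>i=1..n. tail P \<kappa> i) + (\<Sum>i=1..n. tail P \<kappa> (Suc i)))"
      unfolding sum.distrib by (simp only: sum_constant card_atLeastAtMost diff_Suc_1)
    \<comment> \<open>Both tail sums are bounded by the one up to \<open>n + 1\<close>, which
      accounts for the factor 2.\<close>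
    also have "\<dots> \<le> real m ^ 2 + n * (C P * \<eta>)
        + 2 * (real (n + 1) / P + \<kappa> * real (n + 1) * (1 + ln (real (n + 1))))"
    proof -
      have "(\<Sum>i=1..n. of_bool (i \<le> m\<^sup>2)) = real (card ({1..n} \<inter> {i. i \<le> m\<^sup>2}))" by simp
      also have "\<dots> \<le> card {1..m\<^sup>2}" by (intro of_nat_mono card_mono) auto
      finally have 1: "(\<Sum>i=1..n. of_bool (i \<le> m\<^sup>2)) \<le> real m ^ 2" by simp
      have total: "(\<Sum>i=1..n + 1. tail P \<kappa> i) \<le> real (n + 1) / P + \<kappa> * real (n + 1) * (1 + ln (real (n + 1)))"
        using P \<eta> by (intro sum_tail_le) (auto simp: \<kappa>_def)
      have 2: "(\<Sum>i=1..n. tail P \<kappa> i) \<le> (\<Sum>i=1..n + 1. tail P \<kappa> i)" using tail by simp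
      have "(\<Sum>i=1..n. tail P \<kappa> (Suc i)) = (\<Sum>i\<in>{Suc 1..Suc n}. tail P \<kappa> i)"
        by (rule sum.shift_bounds_cl_Suc_ivl[symmetric])
      also have "\<dots> \<le> (\<Sum>i=1..n + 1. tail P \<kappa> i)" using tail by (intro sum_mono2) auto
      finally have 3: "(\<Sum>i=1..n. tail P \<kappa> (Suc i)) \<le> (\<Sum>i=1..n + 1. tail P \<kappa> i)" .
      have "a + b + (u + v) \<le> a' + b + 2 * t" if "a \<le> a'" "u \<le> s" "v \<le> s" "s \<le> t" for a b u v a' s t :: real
        using that by linarith
      from this[OF 1 2 3 total] show ?thesis .
    qed
    also have "\<dots> = n * e P m"
    proof -
      have "real m \<noteq> 0" using m by simp
      then have m4: "real m ^ 4 \<noteq> 0" and m2: "real m ^ 4 * (1 / real m ^ 2) = real m ^ 2"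
        by (simp_all add: field_simps eval_nat_numeral)
      have split: "N * (u + v + 2 * ((N + 1) / N) * (1 / p + t)) = N * u + N * v + 2 * ((N + 1) / p + t * (N + 1))"
        if "N \<noteq> 0" for N u v p t :: real
        using that by (simp add: field_simps) (simp add: add_divide_distrib)
      have n1: "real (n + 1) = real m ^ 4 + 1" using n by simp
      show ?thesis
        unfolding e_def n1 n(1) split[OF m4] m2 \<eta>_def \<kappa>_def by (simp add: ac_simps)
    qed
    finally have "\<bar>(\<Sum>i=1..n. predicted_pair (m\<^sup>2) i \<omega>) - (\<Sum>i=1..n. ?s P i)\<bar> \<le> n * e P m" .
    then have "\<bar>(\<Sum>i=1..n. predicted_pair (m\<^sup>2) i \<omega>) - (\<Sum>i=1..n. ?s P i)\<bar> / n \<le> e P m"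
      using n(2) by (simp add: divide_le_eq mult.commute)
    then show "\<bar>(\<Sum>i=1..m ^ 4. predicted_pair (m\<^sup>2) i \<omega>) / real (m ^ 4) - (\<Sum>i=1..m ^ 4. ?s P i) / real (m ^ 4)\<bar> \<le> e P m"
      unfolding n_def[symmetric] by (simp add: abs_divide flip: diff_divide_distrib)
  qed (rule prime_product_tendsto[OF k])
qed

text \<open>Adding the deviations to the predictions gives the pairs along fourth powers;
  nonnegativity of the pairs fills the gaps.\<close>

lemma AE_mean_pair:
  "AE \<omega> in M. (\<lambda>n. (\<Sum>i=1..n. pair i \<omega>) / real n) \<longlonglongrightarrow> (\<Prod>p. if prime p then 1 - 2 / real p ^ k else 1)"
proof -
  have "AE \<omega> in M. \<forall>i\<in>{1..}. W i \<omega> < k"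
    using AE_W_less by (intro AE_ball_countable'[of "{1..}"]) auto
  with AE_mean_deviation show ?thesis
  proof eventually_elim
    case (elim \<omega>)
    have "\<forall>i\<ge>1. W i \<omega> < k" using elim(2) by auto
    from tendsto_add[OF elim(1) mean_predicted_pair[OF this]]
    have "(\<lambda>m. (\<Sum>i=1..m ^ 4. pair i \<omega>) / real (m ^ 4))
            \<longlonglongrightarrow> (\<Prod>p. if prime p then 1 - 2 / real p ^ k else 1)"
      by (simp add: deviation_def sum_subtractf diff_divide_distrib)
    then show ?case by (rule mean_tendsto_of_fourth_powers[OF pair_bounds(1)])
  qed
qed

end

theorem theorem1p3:
  fixes M :: "'a measure" and k q :: nat
    and alpha :: "nat \<Rightarrow> nat \<Rightarrow> real"
    and tp :: "nat \<Rightarrow> nat"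
    and W :: "nat \<Rightarrow> 'a \<Rightarrow> nat"
  assumes "prob_space M"
    and "k \<ge> 2" and "q \<ge> 1"
    and "\<forall>t<q. \<forall>j<k. 0 < alpha t j \<and> alpha t j < 1"
    and "\<forall>t<q. (\<Sum>j<k. alpha t j) = 1"
    and "\<forall>i\<ge>1. tp i < q"
    and "\<forall>i\<ge>1. W i \<in> measurable M (count_space UNIV)"
    and "prob_space.indep_vars M (\<lambda>_. count_space UNIV) W {1..}"
    and "\<forall>i\<ge>1. \<forall>j<k. measure M {\<omega> \<in> space M. W i \<omega> = j} = alpha (tp i) j"
  shows "AE \<omega> in M. (\<lambda>n. (1 / real n) * (\<Sum>i=1..n. vis_ind k W i \<omega> * vis_ind k W (i+1) \<omega>))
            \<longlonglongrightarrow> (\<Prod>p. if prime p then 1 - 2 / real p ^ k else 1)"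
proof -
  interpret prob_space M by fact
  interpret type_walk M k q alpha tp W
    by unfold_locales (use assms in auto)
  have "vis_ind k W i \<omega> = vis k (walk_pos W i \<omega>)" for i \<omega>
    by (simp add: vis_ind_def vis_def)
  then show ?thesis using AE_mean_pair by (simp add: pair_def)
qed

end
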